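(* Let $G$ be a connected $(c,d)$-biregular simple graph with $c,d\ge 2$ and $(c,d)\neq(2,2)$, having $n$ vertices and $m$ edges. Let $r$ be the number of vertices of degree $c$ and $s$ the number of vertices of degree $d$, and suppose $r\ge s$. Then \[ \mathscr{K}_{nb}(G)=\frac{2(m-n+1)(c-1)(d-1)}{(c-1)(d-1)-1}+\frac{2(r-s)(d-1)}{d}+\frac12+2(s-1)+\frac{cd-c-d}{cd}\left[\mathscr{K}_e(G)-2m+n-\frac12-(r-s)\right]. \]
   Context: A $(c,d)$-biregular graph is a bipartite graph in which every vertex in one part of the bipartition has degree $c$ and every vertex in the other part has degree $d$. Kemeny's constant of an irreducible finite Markov chain with transition matrix $P$ whose eigenvalues (with multiplicity) are $1=\rho_1,\rho_2,\dots,\rho_N$ (with $1$ simple) is $\mathscr{K}(P)=\sum_{i=2}^{N}\frac{1}{1-\rho_i}$. Arcs of $G$: for each edge $\{u,v\}$ the two ordered pairs $(u,v),(v,u)$. $\mathscr{K}_e(G)$ is Kemeny's constant of the chain on arcs where from $(u,v)$ one moves to $(v,w)$ with probability $1/\deg(v)$ for each neighbor $w$ of $v$. $\mathscr{K}_{nb}(G)$ is Kemeny's constant of the non-backtracking chain on arcs where from $(u,v)$ one moves to $(v,w)$ with probability $1/(\deg(v)-1)$ for each neighbor $w\neq u$ of $v$. *)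

theory Defs
  imports "HOL-Computational_Algebra.Polynomial" "Jordan_Normal_Form.Char_Poly"
begin

text \<open>A chain on a finite state set S with transition probabilities T. Its transition
  matrix is formed w.r.t. an (arbitrary) enumeration of S; the spectrum does not depend on it.\<close>

definition state_enum :: "'b set \<Rightarrow> nat \<Rightarrow> 'b" where
  "state_enum S = (SOME f. bij_betw f {0..<card S} S)"

definition trans_matrix :: "'b set \<Rightarrow> ('b \<Rightarrow> 'b \<Rightarrow> real) \<Rightarrow> complex mat" where
  "trans_matrix S T = mat (card S) (card S)
     (\<lambda>(i, j). complex_of_real (T (state_enum S i) (state_enum S j)))"

definition eigenvalues_mset :: "complex mat \<Rightarrow> complex multiset" where
  "eigenvalues_mset A = proots (char_poly A)"

definition kemeny :: "'b set \<Rightarrow> ('b \<Rightarrow> 'b \<Rightarrow> real) \<Rightarrow> complex" where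
  "kemeny S T = (\<Sum>\<^sub># (image_mset (\<lambda>\<rho>. 1 / (1 - \<rho>))
                     (eigenvalues_mset (trans_matrix S T) - {#1#})))"

definition simple_graph :: "'a set \<Rightarrow> ('a \<Rightarrow> 'a \<Rightarrow> bool) \<Rightarrow> bool" where
  "simple_graph V E \<longleftrightarrow> finite V \<and> (\<forall>u v. E u v \<longrightarrow> u \<in> V \<and> v \<in> V)
     \<and> (\<forall>u v. E u v \<longrightarrow> E v u) \<and> (\<forall>v. \<not> E v v)"

definition nbrs :: "'a set \<Rightarrow> ('a \<Rightarrow> 'a \<Rightarrow> bool) \<Rightarrow> 'a \<Rightarrow> 'a set" where
  "nbrs V E v = {w \<in> V. E v w}"

definition deg :: "'a set \<Rightarrow> ('a \<Rightarrow> 'a \<Rightarrow> bool) \<Rightarrow> 'a \<Rightarrow> nat" where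
  "deg V E v = card (nbrs V E v)"

definition connected_graph :: "'a set \<Rightarrow> ('a \<Rightarrow> 'a \<Rightarrow> bool) \<Rightarrow> bool" where
  "connected_graph V E \<longleftrightarrow> V \<noteq> {} \<and> (\<forall>u\<in>V. \<forall>v\<in>V. E\<^sup>*\<^sup>* u v)"

definition edges :: "'a set \<Rightarrow> ('a \<Rightarrow> 'a \<Rightarrow> bool) \<Rightarrow> 'a set set" where
  "edges V E = {{u, v} | u v. u \<in> V \<and> v \<in> V \<and> E u v}"

definition arcs :: "'a set \<Rightarrow> ('a \<Rightarrow> 'a \<Rightarrow> bool) \<Rightarrow> ('a \<times> 'a) set" where
  "arcs V E = {(u, v). u \<in> V \<and> v \<in> V \<and> E u v}"

definition biregular_parts :: "'a set \<Rightarrow> ('a \<Rightarrow> 'a \<Rightarrow> bool) \<Rightarrow> nat \<Rightarrow> nat \<Rightarrow> 'a set \<Rightarrow> 'a set \<Rightarrow> bool" where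
  "biregular_parts V E c d X Y \<longleftrightarrow> X \<union> Y = V \<and> X \<inter> Y = {}
     \<and> (\<forall>u v. E u v \<longrightarrow> (u \<in> X \<and> v \<in> Y) \<or> (u \<in> Y \<and> v \<in> X))
     \<and> (\<forall>v\<in>X. deg V E v = c) \<and> (\<forall>v\<in>Y. deg V E v = d)"

definition edge_walk :: "'a set \<Rightarrow> ('a \<Rightarrow> 'a \<Rightarrow> bool) \<Rightarrow> 'a \<times> 'a \<Rightarrow> 'a \<times> 'a \<Rightarrow> real" where
  "edge_walk V E a b = (if snd a = fst b then 1 / real (deg V E (snd a)) else 0)"

definition nb_walk :: "'a set \<Rightarrow> ('a \<Rightarrow> 'a \<Rightarrow> bool) \<Rightarrow> 'a \<times> 'a \<Rightarrow> 'a \<times> 'a \<Rightarrow> real" where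
  "nb_walk V E a b = (if snd a = fst b \<and> snd b \<noteq> fst a
                       then 1 / (real (deg V E (snd a)) - 1) else 0)"

definition kemeny_e :: "'a set \<Rightarrow> ('a \<Rightarrow> 'a \<Rightarrow> bool) \<Rightarrow> complex" where
  "kemeny_e V E = kemeny (arcs V E) (edge_walk V E)"

definition kemeny_nb :: "'a set \<Rightarrow> ('a \<Rightarrow> 'a \<Rightarrow> bool) \<Rightarrow> complex" where
  "kemeny_nb V E = kemeny (arcs V E) (nb_walk V E)"

end

theory Submission
  imports Defs
begin

text \<open>
  Both arc chains have a characteristic polynomial that is determined by the eigenvalues \<open>\<mu>\<close> of
  the two-step random walk on \<open>Y\<close>. For the edge walk, Sylvester's identity reduces arcs to vertices
  and a Schur complement reduces vertices to \<open>Y\<close>, which gives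
  \<open>x ^ (2m - n + r - s) \<Prod> (x\<^sup>2 - \<mu>)\<close>. For the non-backtracking walk, with
  \<open>\<kappa> = 1 / ((c - 1) (d - 1))\<close>, an Ihara-Bass argument gives
  \<open>(x\<^sup>2 - \<kappa>) ^ (m - n) (x\<^sup>2 + 1 / (d - 1)) ^ (r - s)
  \<Prod> ((x\<^sup>2 + 1 / (d - 1)) (x\<^sup>2 + 1 / (c - 1)) - \<kappa> c d \<mu> x\<^sup>2)\<close>. Each factor contributes its logarithmic
  derivative at 1 to Kemeny's constant. The eigenvalue \<open>\<mu> = 1\<close> is simple because \<open>G\<close> is connected;
  its quartic factor splits as \<open>(x\<^sup>2 - 1) (x\<^sup>2 - \<kappa>)\<close>.
\<close>

section \<open>Determinants of matrices indexed by a finite set\<close>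

text \<open>Uses the enumeration from \<open>trans_matrix\<close>, so that a determinant can be
  handled entirely in terms of arcs or vertices instead of positions.\<close>

definition fdet :: "'b set \<Rightarrow> ('b \<Rightarrow> 'b \<Rightarrow> 'k::field) \<Rightarrow> 'k" where
  "fdet S f = det (mat (card S) (card S) (\<lambda>(i, j). f (state_enum S i) (state_enum S j)))"

lemma bij_betw_state_enum: "finite S \<Longrightarrow> bij_betw (state_enum S) {0..<card S} S"
  unfolding state_enum_def by (drule ex_bij_betw_nat_finite) (erule someI_ex)

text \<open>Only the summed index has to run bijectively through \<open>T\<close>; \<open>a\<close>
  and \<open>b\<close> stay arbitrary, which admits products of matrices whose rows and columns
  follow different enumerations.\<close>

lemma mat_mult_enum:
  assumes "bij_betw e {0..<k} T"
  shows "mat n k (\<lambda>(i, j). f (a i) (e j)) * mat k l (\<lambda>(i, j). g (e i) (b j))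
    = mat n l (\<lambda>(i, j). \<Sum>t\<in>T. f (a i) t * g t (b j) :: 'k::comm_ring_1)"
  using assms
  by (intro eq_matI)
     (auto simp: scalar_prod_def simp flip: sum.reindex_bij_betw[OF assms])

lemma mat_delta_enum:
  assumes "inj_on e {0..<n}"
  shows "mat n n (\<lambda>(i, j). of_bool (e i = e j)) = (1\<^sub>m n :: 'k::comm_ring_1 mat)"
  using assms by (intro eq_matI) (auto simp: inj_on_eq_iff)

text \<open>Changing the enumeration conjugates by a permutation matrix. With \<open>?I\<close> as
  entry function, \<open>?M ?I e ?e'\<close> is that matrix and \<open>?M ?I ?e' e\<close> is its
  inverse.\<close>

lemma det_mat_enum:
  fixes f :: "'b \<Rightarrow> 'b \<Rightarrow> 'k::field"
  assumes S: "finite S" and e: "bij_betw e {0..<card S} S"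
  shows "det (mat (card S) (card S) (\<lambda>(i, j). f (e i) (e j))) = fdet S f"
proof -
  let ?n = "card S" and ?e' = "state_enum S"
  let ?M = "\<lambda>f a b. mat ?n ?n (\<lambda>(i, j). f (a i :: 'b) (b j :: 'b)) :: 'k mat"
  let ?I = "\<lambda>x y :: 'b. of_bool (x = y) :: 'k"
  note e' = bij_betw_state_enum[OF S]
  have sumI: "(\<Sum>t\<in>S. g t * of_bool (t = y)) = g y" if "y \<in> S" for g :: "'b \<Rightarrow> 'k" and y
    using S that by (simp add: of_bool_def if_distrib cong: if_cong)
  have sumI': "(\<Sum>t\<in>S. of_bool (y = t) * g t) = g y" if "y \<in> S" for g :: "'b \<Rightarrow> 'k" and y
    using S that by (simp add: of_bool_def if_distribR if_distrib cong: if_cong)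
  have eS: "e i \<in> S" "?e' i \<in> S" if "i < ?n" for i
    using bij_betwE[OF e] bij_betwE[OF e'] that by auto
  have "?M ?I e ?e' * ?M ?I ?e' e = ?M (\<lambda>x y. \<Sum>t\<in>S. ?I x t * ?I t y) e e"
    by (rule mat_mult_enum[OF e'])
  also have "\<dots> = ?M ?I e e"
    by (rule eq_matI) (auto simp: eS sumI' simp del: of_bool_eq)
  also have "\<dots> = 1\<^sub>m ?n"
    using e by (intro mat_delta_enum) (auto simp: bij_betw_def)
  finally have 1: "?M ?I e ?e' * ?M ?I ?e' e = 1\<^sub>m ?n" .
  have "?M ?I ?e' e * ?M ?I e ?e' = ?M (\<lambda>x y. \<Sum>t\<in>S. ?I x t * ?I t y) ?e' ?e'"
    by (rule mat_mult_enum[OF e])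
  also have "\<dots> = ?M ?I ?e' ?e'"
    by (rule eq_matI) (auto simp: eS sumI' simp del: of_bool_eq)
  also have "\<dots> = 1\<^sub>m ?n"
    using e' by (intro mat_delta_enum) (auto simp: bij_betw_def)
  finally have 2: "?M ?I ?e' e * ?M ?I e ?e' = 1\<^sub>m ?n" .
  have "?M ?I e ?e' * ?M f ?e' ?e' = ?M (\<lambda>x y. \<Sum>t\<in>S. ?I x t * f t y) e ?e'"
    by (rule mat_mult_enum[OF e'])
  also have "\<dots> = ?M f e ?e'"
    by (rule eq_matI) (auto simp: eS sumI' simp del: of_bool_eq)
  finally have 3: "?M ?I e ?e' * ?M f ?e' ?e' * ?M ?I ?e' e = ?M f e ?e' * ?M ?I ?e' e"
    by simp
  also have "\<dots> = ?M (\<lambda>x y. \<Sum>t\<in>S. f x t * ?I t y) e e"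
    by (rule mat_mult_enum[OF e'])
  also have "\<dots> = ?M f e e"
    by (rule eq_matI) (auto simp: eS sumI simp del: of_bool_eq)
  finally have 3: "?M f e e = ?M ?I e ?e' * ?M f ?e' ?e' * ?M ?I ?e' e" by simp
  have "similar_mat (?M f e e) (?M f ?e' ?e')"
    by (rule similar_matI[OF _ 1 2 3]) auto
  from det_similar[OF this] show ?thesis by (simp add: fdet_def)
qed

lemma fdet_cong:
  assumes "finite S" "\<And>x y. x \<in> S \<Longrightarrow> y \<in> S \<Longrightarrow> f x y = g x y"
  shows "fdet S f = fdet S g"
  unfolding fdet_def using bij_betwE[OF bij_betw_state_enum[OF assms(1)]] assms(2)
  by (intro arg_cong[of _ _ det] eq_matI) auto

lemma fdet_mult:
  assumes "finite S"
  shows "fdet S f * fdet S g = fdet S (\<lambda>x y. \<Sum>t\<in>S. f x t * g t y)"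
  unfolding fdet_def mat_mult_enum[OF bij_betw_state_enum[OF assms], symmetric]
  by (rule det_mult[symmetric]) auto

lemma fdet_scalar:
  assumes "finite S"
  shows "fdet S (\<lambda>x y. a * of_bool (x = y)) = a ^ card S"
proof -
  have "mat (card S) (card S) (\<lambda>(i, j). a * of_bool (state_enum S i = state_enum S j)) = a \<cdot>\<^sub>m 1\<^sub>m (card S)"
    using bij_betw_state_enum[OF assms]
    by (intro eq_matI) (auto simp: bij_betw_def inj_on_eq_iff)
  then show ?thesis by (simp add: fdet_def)
qed

lemma fdet_scale:
  "fdet S (\<lambda>x y. a * f x y) = a ^ card S * fdet S f"
proof -
  have "mat (card S) (card S) (\<lambda>(i, j). a * f (state_enum S i) (state_enum S j))
     = a \<cdot>\<^sub>m mat (card S) (card S) (\<lambda>(i, j). f (state_enum S i) (state_enum S j))"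
    by (intro eq_matI) auto
  then show ?thesis by (simp add: fdet_def)
qed

lemma fdet_reindex:
  assumes "finite S" "inj_on h S"
  shows "fdet (h ` S) f = fdet S (\<lambda>x y. f (h x) (h y))"
proof -
  have "bij_betw (h \<circ> state_enum S) {0..<card S} (h ` S)"
    using assms by (intro bij_betw_trans[OF bij_betw_state_enum]) (auto simp: bij_betw_def)
  from det_mat_enum[of "h ` S" "h \<circ> state_enum S" f] this assms show ?thesis
    by (simp add: card_image fdet_def)
qed

section \<open>Block determinants, Schur complements and Sylvester's identity\<close>

lemma
  assumes fin: "finite X" "finite Y" and disj: "X \<inter> Y = {}"
  shows fdet_upper_right_zero:
      "(\<And>x y. x \<in> X \<Longrightarrow> y \<in> Y \<Longrightarrow> f x y = 0) \<Longrightarrow> fdet (X \<union> Y) f = fdet X f * fdet Y f"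
    and fdet_lower_left_zero:
      "(\<And>x y. x \<in> X \<Longrightarrow> y \<in> Y \<Longrightarrow> f y x = 0) \<Longrightarrow> fdet (X \<union> Y) f = fdet X f * fdet Y f"
proof -
  let ?r = "card X" and ?s = "card Y"
  \<comment> \<open>Listing \<open>X\<close> before \<open>Y\<close> exhibits the matrix in block
    form; \<open>det_mat_enum\<close> allows this enumeration in place of the chosen one.\<close>
  define e where "e i = (if i < ?r then state_enum X i else state_enum Y (i - ?r))" for i
  note eX = bij_betw_state_enum[OF fin(1)] and eY = bij_betw_state_enum[OF fin(2)]
  have card: "card (X \<union> Y) = ?r + ?s" using fin disj by (rule card_Un_disjoint)
  have 1: "bij_betw e {0..<?r} X"
    using eX by (rule bij_betw_cong[THEN iffD1, rotated]) (auto simp: e_def)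
  have shift: "bij_betw (\<lambda>i. i - ?r) {?r..<?r + ?s} {0..<?s}"
    by (rule bij_betw_byWitness[where f' = "\<lambda>i. i + ?r"]) auto
  have 2: "bij_betw e {?r..<?r + ?s} Y"
    using bij_betw_trans[OF shift eY]
    by (rule bij_betw_cong[THEN iffD1, rotated]) (auto simp: e_def)
  have "bij_betw e ({0..<?r} \<union> {?r..<?r + ?s}) (X \<union> Y)"
    using 1 2 disj by (rule bij_betw_combine)
  also have "{0..<?r} \<union> {?r..<?r + ?s} = {0..<card (X \<union> Y)}" by (auto simp: card)
  finally have "fdet (X \<union> Y) f = det (mat (card (X \<union> Y)) (card (X \<union> Y)) (\<lambda>(i, j). f (e i) (e j)))"
    using fin by (intro det_mat_enum[symmetric]) auto
  also have "mat (card (X \<union> Y)) (card (X \<union> Y)) (\<lambda>(i, j). f (e i) (e j)) = four_block_mat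
      (mat ?r ?r (\<lambda>(i, j). f (state_enum X i) (state_enum X j)))
      (mat ?r ?s (\<lambda>(i, j). f (state_enum X i) (state_enum Y j)))
      (mat ?s ?r (\<lambda>(i, j). f (state_enum Y i) (state_enum X j)))
      (mat ?s ?s (\<lambda>(i, j). f (state_enum Y i) (state_enum Y j)))" (is "_ = four_block_mat ?A ?B ?C ?D")
    by (rule eq_matI) (auto simp: card e_def)
  finally have *: "fdet (X \<union> Y) f = det (four_block_mat ?A ?B ?C ?D)" .
  note E = bij_betwE[OF eX] bij_betwE[OF eY]
  show "fdet (X \<union> Y) f = fdet X f * fdet Y f" if "\<And>x y. x \<in> X \<Longrightarrow> y \<in> Y \<Longrightarrow> f x y = 0"
  proof -
    have "?B = 0\<^sub>m ?r ?s" using E that by (intro eq_matI) auto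
    then show ?thesis unfolding * unfolding fdet_def
      by (intro det_four_block_mat_upper_right_zero) auto
  qed
  show "fdet (X \<union> Y) f = fdet X f * fdet Y f" if "\<And>x y. x \<in> X \<Longrightarrow> y \<in> Y \<Longrightarrow> f y x = 0"
  proof -
    have "?C = 0\<^sub>m ?s ?r" using E that by (intro eq_matI) auto
    then show ?thesis unfolding * unfolding fdet_def
      by (intro det_four_block_mat_lower_left_zero) auto
  qed
qed

text \<open>Schur complement with denominators cleared, so it needs no invertibility of
  \<open>a\<close>. Column operations remove the block from \<open>X\<close> to \<open>Y\<close>,
  leaving a block triangular matrix.\<close>

lemma fdet_Schur:
  fixes f :: "'b \<Rightarrow> 'b \<Rightarrow> 'k::field"
  assumes fin: "finite X" "finite Y" and disj: "X \<inter> Y = {}"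
    and scal: "\<And>x x'. x \<in> X \<Longrightarrow> x' \<in> X \<Longrightarrow> f x x' = a * of_bool (x = x')"
  shows "fdet (X \<union> Y) f * a ^ card Y
    = a ^ card X * fdet Y (\<lambda>y y'. a * f y y' - (\<Sum>x\<in>X. f y x * f x y'))"
proof -
  \<comment> \<open>In blocks, \<open>g\<close> has identity and \<open>- f\<close> in the rows of
    \<open>X\<close>, zero and \<open>a\<close> times the identity in the rows of \<open>Y\<close>.
    Its determinant is \<open>a ^ card Y\<close>.\<close>
  define g where "g x y = (if x \<in> X \<and> y \<in> Y then - f x y
    else if x \<in> Y \<and> x = y then a else of_bool (x = y))" for x y
  define h where "h x y = (\<Sum>t\<in>X \<union> Y. f x t * g t y)" for x y
  have g: "fdet (X \<union> Y) g = fdet X g * fdet Y g"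
    by (rule fdet_lower_left_zero[OF fin disj]) (use disj in \<open>auto simp: g_def\<close>)
  have gX: "fdet X g = 1"
    using fdet_scalar[OF fin(1), of "1::'k"] disj
    by (subst fdet_cong[OF fin(1), of g "\<lambda>x y. 1 * of_bool (x = y)"]) (auto simp: g_def)
  have gY: "fdet Y g = a ^ card Y"
    using fdet_scalar[OF fin(2), of a] disj
    by (subst fdet_cong[OF fin(2), of g "\<lambda>x y. a * of_bool (x = y)"]) (auto simp: g_def)
  have hs: "h x y = (\<Sum>t\<in>X. f x t * g t y) + (\<Sum>t\<in>Y. f x t * g t y)" for x y
    unfolding h_def using fin disj by (rule sum.union_disjoint)
  have hX: "h x y = f x y" if "y \<in> X" for x y
  proof -
    have "(\<Sum>t\<in>X. f x t * g t y) = (\<Sum>t\<in>X. if t = y then f x t else 0)"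
      using that disj by (intro sum.cong) (auto simp: g_def)
    moreover have "(\<Sum>t\<in>Y. f x t * g t y) = 0"
      using that disj by (intro sum.neutral) (auto simp: g_def)
    ultimately show ?thesis using that fin by (simp add: hs)
  qed
  have hY: "h x y = a * f x y - (\<Sum>t\<in>X. f x t * f t y)" if "y \<in> Y" for x y
  proof -
    have "(\<Sum>t\<in>X. f x t * g t y) = - (\<Sum>t\<in>X. f x t * f t y)"
      unfolding sum_negf[symmetric] using that disj by (intro sum.cong) (auto simp: g_def)
    moreover have "(\<Sum>t\<in>Y. f x t * g t y) = (\<Sum>t\<in>Y. if t = y then a * f x t else 0)"
      using that disj by (intro sum.cong) (auto simp: g_def)
    ultimately show ?thesis using that fin by (simp add: hs)
  qed
  \<comment> \<open>Here the scalar shape of the \<open>X\<close> block is used: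
    \<open>a * f x y\<close> cancels against the sum, which collapses to its term at
    \<open>x\<close>.\<close>
  have h0: "h x y = 0" if "x \<in> X" "y \<in> Y" for x y
  proof -
    have "(\<Sum>t\<in>X. f x t * f t y) = (\<Sum>t\<in>X. if x = t then a * f t y else 0)"
      using that by (intro sum.cong) (auto simp: scal)
    then show ?thesis using that fin by (simp add: hY)
  qed
  have "fdet (X \<union> Y) f * fdet (X \<union> Y) g = fdet (X \<union> Y) h"
    unfolding h_def using fin by (intro fdet_mult) auto
  also have "\<dots> = fdet X h * fdet Y h"
    by (rule fdet_upper_right_zero[OF fin disj h0])
  also have "fdet X h = a ^ card X"
    using fdet_scalar[OF fin(1), of a]
    by (subst fdet_cong[OF fin(1), of h "\<lambda>x y. a * of_bool (x = y)"]) (auto simp: hX scal)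
  also have "fdet Y h = fdet Y (\<lambda>y y'. a * f y y' - (\<Sum>x\<in>X. f y x * f x y'))"
    by (rule fdet_cong[OF fin(2)]) (simp add: hY)
  finally show ?thesis by (simp add: g gX gY)
qed

text \<open>Both sides come from one block matrix on the disjoint sum, with diagonal blocks
  \<open>a\<close> and 1 and off-diagonal blocks \<open>u\<close> and \<open>v\<close>: eliminating
  \<open>S\<close> gives one determinant, eliminating \<open>T\<close> the other.\<close>

lemma fdet_Sylvester:
  fixes u :: "'b \<Rightarrow> 'c \<Rightarrow> 'k::field"
  assumes fin: "finite S" "finite T"
  shows "fdet S (\<lambda>x y. a * of_bool (x = y) - (\<Sum>t\<in>T. u x t * v t y)) * a ^ card T
    = a ^ card S * fdet T (\<lambda>x y. a * of_bool (x = y) - (\<Sum>t\<in>S. v x t * u t y))"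
proof -
  define f where "f p q = (case (p, q) of (Inl x, Inl y) \<Rightarrow> a * of_bool (x = y)
    | (Inl x, Inr y) \<Rightarrow> u x y | (Inr x, Inl y) \<Rightarrow> v x y | (Inr x, Inr y) \<Rightarrow> of_bool (x = y))" for p q
  let ?S = "Inl ` S :: ('b + 'c) set" and ?T = "Inr ` T :: ('b + 'c) set"
  have fin': "finite ?S" "finite ?T" "?S \<inter> ?T = {}" "?T \<inter> ?S = {}" using fin by auto
  have cards: "card ?S = card S" "card ?T = card T" by (simp_all add: card_image)
  have Inl: "f x x' = a * of_bool (x = x')" if "x \<in> ?S" "x' \<in> ?S" for x x'
    using that by (auto simp: f_def)
  have Inr: "f x x' = 1 * of_bool (x = x')" if "x \<in> ?T" "x' \<in> ?T" for x x'
    using that by (auto simp: f_def)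
  have "fdet (?S \<union> ?T) f * a ^ card T = a ^ card S *
      fdet ?T (\<lambda>y y'. a * f y y' - (\<Sum>x\<in>?S. f y x * f x y'))"
    using fdet_Schur[OF fin'(1-3) Inl] unfolding cards .
  also have "fdet ?T (\<lambda>y y'. a * f y y' - (\<Sum>x\<in>?S. f y x * f x y')) =
      fdet T (\<lambda>x y. a * of_bool (x = y) - (\<Sum>t\<in>S. v x t * u t y))"
    using fin by (subst fdet_reindex) (auto simp: f_def sum.reindex)
  finally have 1: "fdet (?S \<union> ?T) f * a ^ card T
      = a ^ card S * fdet T (\<lambda>x y. a * of_bool (x = y) - (\<Sum>t\<in>S. v x t * u t y))" .
  have "fdet (?T \<union> ?S) f = fdet ?S (\<lambda>y y'. 1 * f y y' - (\<Sum>x\<in>?T. f y x * f x y'))"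
    using fdet_Schur[OF fin'(2,1,4) Inr] by simp
  also have "\<dots> = fdet S (\<lambda>x y. a * of_bool (x = y) - (\<Sum>t\<in>T. u x t * v t y))"
    using fin by (subst fdet_reindex) (auto simp: f_def sum.reindex)
  finally show ?thesis using 1 by (simp add: Un_commute)
qed

lemma fdet_eq_0_imp_kernel:
  assumes "finite S" "fdet S f = 0"
  obtains v where "\<And>x. x \<in> S \<Longrightarrow> (\<Sum>y\<in>S. f x y * v y) = 0" "\<exists>x\<in>S. v x \<noteq> 0"
proof -
  let ?n = "card S" and ?e = "state_enum S"
  let ?A = "mat ?n ?n (\<lambda>(i, j). f (?e i) (?e j))"
  note e = bij_betw_state_enum[OF assms(1)]
  obtain w where w: "w \<in> carrier_vec ?n" "w \<noteq> 0\<^sub>v ?n" "?A *\<^sub>v w = 0\<^sub>v ?n"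
    using assms(2) det_0_iff_vec_prod_zero[of ?A ?n] unfolding fdet_def by auto
  define v where "v x = w $ inv_into {0..<?n} ?e x" for x
  have v: "v (?e i) = w $ i" if "i < ?n" for i
    using e that by (simp add: v_def bij_betw_def)
  show thesis
  proof (rule that)
    fix x assume "x \<in> S"
    then obtain i where i: "i < ?n" "x = ?e i"
      using e unfolding bij_betw_def by force
    have "0 = (?A *\<^sub>v w) $ i" using w i by simp
    also have "\<dots> = (\<Sum>j = 0..<?n. f x (?e j) * v (?e j))"
      using i w(1) by (auto simp: scalar_prod_def v intro!: sum.cong)
    also have "\<dots> = (\<Sum>y\<in>S. f x y * v y)"
      by (rule sum.reindex_bij_betw[OF e])
    finally show "(\<Sum>y\<in>S. f x y * v y) = 0" by simp
  next
    obtain i where "i < ?n" "w $ i \<noteq> 0" using w by (auto simp: vec_eq_iff)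
    then show "\<exists>x\<in>S. v x \<noteq> 0" using bij_betwE[OF e] by (intro bexI[of _ "?e i"]) (auto simp: v)
  qed
qed

section \<open>Characteristic polynomials of matrices indexed by a set\<close>

definition fchar_poly :: "'b set \<Rightarrow> ('b \<Rightarrow> 'b \<Rightarrow> 'k::field) \<Rightarrow> 'k poly" where
  "fchar_poly S f = char_poly (mat (card S) (card S) (\<lambda>(i, j). f (state_enum S i) (state_enum S j)))"

text \<open>Pointwise evaluation lets all determinant manipulations take place over the field;
  polynomial identities are recovered afterwards by \<open>poly_eqI_cofinite\<close>.\<close>

lemma poly_fchar_poly:
  assumes "finite S"
  shows "poly (fchar_poly S f) x = fdet S (\<lambda>a b. x * of_bool (a = b) - f a b)"
  unfolding fchar_poly_def char_poly_def fdet_def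
  by (rule poly_det_cong[of _ "card S"])
     (use bij_betw_state_enum[OF assms] in \<open>auto simp: char_poly_matrix_def bij_betw_def inj_on_eq_iff\<close>)

lemma degree_monic_fchar_poly:
  "degree (fchar_poly S f) = card S" "lead_coeff (fchar_poly S f) = 1"
  using degree_monic_char_poly[of "mat (card S) (card S) (\<lambda>(i, j). f (state_enum S i) (state_enum S j))" "card S"]
  by (simp_all add: fchar_poly_def)

section \<open>Sums over the roots of a polynomial\<close>

text \<open>Additive on products, so it can be read off any factorization of a characteristic
  polynomial. When 1 is not a root it is the logarithmic derivative at 1.\<close>

definition root_sum :: "complex poly \<Rightarrow> complex" where
  "root_sum p = (\<Sum>\<rho>\<in>#proots p. 1 / (1 - \<rho>))"

text \<open>Since \<open>1 / 0 = 0\<close>, deleting one copy of the eigenvalue 1 does not change the sum.\<close>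

lemma kemeny_eq_root_sum:
  "kemeny S T = root_sum (fchar_poly S (\<lambda>a b. complex_of_real (T a b)))"
proof -
  let ?M = "proots (fchar_poly S (\<lambda>a b. complex_of_real (T a b)))"
  have "(\<Sum>\<rho>\<in>#?M - {#1#}. 1 / (1 - \<rho>)) = (\<Sum>\<rho>\<in>#?M. 1 / (1 - \<rho>))"
  proof (cases "1 \<in># ?M")
    case True
    then obtain N where "?M = add_mset 1 N" by (rule mset_add)
    then show ?thesis by simp
  qed (simp add: diff_single_trivial)
  then show ?thesis
    by (simp add: kemeny_def eigenvalues_mset_def trans_matrix_def fchar_poly_def root_sum_def)
qed

lemma root_sum_1: "root_sum 1 = 0"
  by (simp add: root_sum_def)

lemma root_sum_mult: "p \<noteq> 0 \<Longrightarrow> q \<noteq> 0 \<Longrightarrow> root_sum (p * q) = root_sum p + root_sum q"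
  by (simp add: root_sum_def proots_mult)

lemma root_sum_power: "p \<noteq> 0 \<Longrightarrow> root_sum (p ^ n) = of_nat n * root_sum p"
  by (induction n) (simp_all add: root_sum_mult root_sum_1 ring_distribs)

lemma root_sum_prod_mset:
  "(\<And>x. f x \<noteq> 0) \<Longrightarrow> root_sum (\<Prod>x\<in>#M. f x) = (\<Sum>x\<in>#M. root_sum (f x))"
proof (induction M)
  case empty
  show ?case by (simp add: root_sum_def)
next
  case (add x M)
  have "(\<Prod>x\<in>#M. f x) \<noteq> 0" using add.prems by (auto simp: prod_mset_zero_iff)
  then show ?case using add by (simp add: root_sum_mult)
qed

lemma root_sum_linear: "root_sum [:- a, 1:] = 1 / (1 - a)"
  by (simp add: root_sum_def)

lemma complex_poly_eq_prod_proots: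
  "(p :: complex poly) = Polynomial.smult (lead_coeff p) (\<Prod>\<rho>\<in>#proots p. [:- \<rho>, 1:])"
proof (cases "p = 0")
  case False
  then obtain A where A: "p = Polynomial.smult (lead_coeff p) (\<Prod>\<rho>\<in>#A. [:- \<rho>, 1:])"
    using alg_closed_imp_factorization by blast
  have "proots p = proots (\<Prod>\<rho>\<in>#A. [:- \<rho>, 1:])"
    using False by (subst A) simp
  also have "\<dots> = A"
    by (induction A) (auto simp: proots_mult prod_mset_zero_iff image_iff simp del: mult_pCons_left)
  finally show ?thesis using A by simp
qed simp

text \<open>Gives the contribution of a quadratic or quartic factor without solving for its roots.
  The product rule handles monic split products, and the leading coefficient cancels in the
  quotient.\<close>

lemma root_sum_log_deriv:
  assumes "poly p 1 \<noteq> 0"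
  shows "root_sum p = poly (pderiv p) 1 / poly p 1"
proof -
  have *: "poly (pderiv (\<Prod>\<rho>\<in>#M. [:- \<rho>, 1:])) 1 = poly (\<Prod>\<rho>\<in>#M. [:- \<rho>, 1:]) 1 * (\<Sum>\<rho>\<in>#M. 1 / (1 - \<rho>))"
    if "1 \<notin># M" for M :: "complex multiset"
    using that
  proof (induction M)
    case (add x M)
    define P \<sigma> where "P = (\<Prod>\<rho>\<in>#M. [:- \<rho>, 1:])" and "\<sigma> = (\<Sum>\<rho>\<in>#M. 1 / (1 - \<rho>))"
    have "poly (pderiv ([:- x, 1:] * P)) 1 = (1 - x) * poly (pderiv P) 1 + poly P 1"
      unfolding pderiv_mult by (simp add: pderiv_pCons algebra_simps)
    also have "poly (pderiv P) 1 = poly P 1 * \<sigma>"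
      unfolding P_def \<sigma>_def using add by simp
    also have "(1 - x) * (poly P 1 * \<sigma>) + poly P 1 = (1 - x) * poly P 1 * (1 / (1 - x) + \<sigma>)"
      using add.prems by (simp add: field_simps)
    also have "(1 - x) * poly P 1 = poly ([:- x, 1:] * P) 1"
      by (simp add: algebra_simps)
    finally show ?case
      by (simp add: P_def \<sigma>_def)
  qed simp
  have 1: "1 \<notin># proots p" using assms by (cases "p = 0") auto
  define Q where "Q = (\<Prod>\<rho>\<in>#proots p. [:- \<rho>, 1:])"
  have p: "p = Polynomial.smult (lead_coeff p) Q"
    unfolding Q_def by (rule complex_poly_eq_prod_proots)
  have "poly (pderiv p) 1 = lead_coeff p * poly (pderiv Q) 1"
    by (subst p) (simp only: pderiv_smult poly_smult)
  also have "\<dots> = (lead_coeff p * poly Q 1) * root_sum p"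
    by (simp only: *[OF 1] Q_def root_sum_def mult.assoc)
  also have "lead_coeff p * poly Q 1 = poly p 1"
    by (subst (2) p) (simp only: poly_smult)
  finally show ?thesis using assms by simp
qed

text \<open>The determinant identities below are obtained only away from finitely many points, where
  the factors to be cancelled are nonzero.\<close>

lemma poly_eqI_cofinite:
  fixes p q :: "'k::{idom, ring_char_0} poly"
  assumes "finite F" "\<And>x. x \<notin> F \<Longrightarrow> poly p x = poly q x"
  shows "p = q"
proof (rule ccontr)
  assume "p \<noteq> q"
  then have "finite {x. poly (p - q) x = 0}" by (intro poly_roots_finite) simp
  moreover have "UNIV = F \<union> {x. poly (p - q) x = 0}" using assms(2) by auto
  ultimately have "finite (UNIV :: 'k set)" using assms(1) by (metis finite_Un)
  then show False using infinite_UNIV_char_0 by blast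
qed

section \<open>Spectra of doubly stochastic matrices\<close>

text \<open>Homogenized characteristic polynomial: take out \<open>z\<close> from every row,
  evaluate at \<open>p / z\<close>, and return one \<open>z\<close> to each linear factor. In the
  applications \<open>p\<close> and \<open>z\<close> depend on the spectral variable.\<close>

lemma fdet_scalar_minus_eq_prod_proots:
  fixes f :: "'b \<Rightarrow> 'b \<Rightarrow> complex"
  assumes "finite S" "z \<noteq> 0"
  shows "fdet S (\<lambda>x y. p * of_bool (x = y) - z * f x y) = (\<Prod>\<mu>\<in>#proots (fchar_poly S f). p - z * \<mu>)"
proof -
  let ?P = "fchar_poly S f"
  have "fdet S (\<lambda>x y. p * of_bool (x = y) - z * f x y) = fdet S (\<lambda>x y. z * (p / z * of_bool (x = y) - f x y))"
    using assms by (intro fdet_cong) (auto simp: field_simps)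
  also have "\<dots> = z ^ card S * poly ?P (p / z)"
    using assms by (simp add: fdet_scale poly_fchar_poly)
  also have "poly ?P (p / z) = (\<Prod>\<mu>\<in>#proots ?P. p / z - \<mu>)"
    by (subst complex_poly_eq_prod_proots)
       (simp add: degree_monic_fchar_poly(2) poly_prod_mset image_mset.compositionality o_def)
  also have "card S = size (proots ?P)"
    by (simp add: size_proots_complex degree_monic_fchar_poly)
  also have "z ^ size M * (\<Prod>\<mu>\<in>#M. p / z - \<mu>) = (\<Prod>\<mu>\<in>#M. p - z * \<mu>)" for M
  proof (induction M)
    case (add x M)
    have "z * (p / z - x) = p - z * x" using assms by (simp add: field_simps)
    then show ?case by (simp flip: add)
  qed simp
  finally show ?thesis .
qed

text \<open>Deflation: replacing \<open>f\<close> by \<open>f - J\<close>, where \<open>J\<close> is the rank one matrix with all entries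
  \<open>1 / card S\<close>, moves exactly one eigenvalue from 1 to 0.\<close>

lemma proots_fchar_poly_doubly_stochastic:
  fixes f :: "'b \<Rightarrow> 'b \<Rightarrow> complex"
  assumes S: "finite S" "S \<noteq> {}"
    and row: "\<And>x. x \<in> S \<Longrightarrow> (\<Sum>y\<in>S. f x y) = 1"
    and col: "\<And>y. y \<in> S \<Longrightarrow> (\<Sum>x\<in>S. f x y) = 1"
    and harm: "\<And>v x y. (\<And>x. x \<in> S \<Longrightarrow> (\<Sum>y\<in>S. f x y * v y) = v x) \<Longrightarrow> x \<in> S \<Longrightarrow> y \<in> S \<Longrightarrow> v x = v y"
  obtains M where "proots (fchar_poly S f) = add_mset 1 M" "1 \<notin># M" "size M = card S - 1"
proof -
  define s where "s = complex_of_nat (card S)"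
  have s0: "s \<noteq> 0" using S by (simp add: s_def)
  define P where "P = fchar_poly S f"
  define R where "R = fchar_poly S (\<lambda>x y. f x y - 1 / s)"
  have "P \<noteq> 0" "R \<noteq> 0"
    using degree_monic_fchar_poly(2)[of S] unfolding P_def R_def by (metis leading_coeff_0_iff zero_neq_one)+
  have eq: "[:-1, 1:] * R = [:-0, 1:] * P"
  proof (rule poly_eqI_cofinite[of "{1}"])
    fix x :: complex assume x: "x \<notin> {1}"
    \<comment> \<open>Row sums 1 make \<open>x - f\<close> map the all-ones vector to
      \<open>x - 1\<close> times itself. Hence multiplying by the identity minus the constant matrix
      \<open>w\<close> subtracts \<open>w * (x - 1)\<close> from every entry, and \<open>w\<close>
      is chosen to make this \<open>- 1 / s\<close>.\<close>
    define w where "w = - 1 / (s * (x - 1))"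
    have x1: "x - 1 \<noteq> 0" using x by simp
    have "poly P x * fdet S (\<lambda>a b. of_bool (a = b) - w)
        = fdet S (\<lambda>a b. \<Sum>t\<in>S. (x * of_bool (a = t) - f a t) * (of_bool (t = b) - w))"
      unfolding P_def poly_fchar_poly[OF S(1)] by (rule fdet_mult[OF S(1)])
    also have "\<dots> = fdet S (\<lambda>a b. x * of_bool (a = b) - (f a b - 1 / s))"
    proof (rule fdet_cong[OF S(1)])
      fix a b assume ab: "a \<in> S" "b \<in> S"
      have "(\<Sum>t\<in>S. (x * of_bool (a = t) - f a t) * (of_bool (t = b) - w))
        = (\<Sum>t\<in>S. (if t = b then x * of_bool (a = b) - f a b else 0)
            - (if a = t then w * x else 0) + w * f a t)"
        by (rule sum.cong) (auto simp: algebra_simps)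
      also have "\<dots> = x * of_bool (a = b) - f a b - w * x + w"
        using ab S row by (simp add: sum.distrib sum_subtractf flip: sum_distrib_left)
      also have "\<dots> = x * of_bool (a = b) - f a b - w * (x - 1)" by (simp add: algebra_simps)
      also have "w * (x - 1) = - 1 / s" using x1 s0 by (simp add: w_def)
      finally show "(\<Sum>t\<in>S. (x * of_bool (a = t) - f a t) * (of_bool (t = b) - w))
        = x * of_bool (a = b) - (f a b - 1 / s)" by simp
    qed
    also have "\<dots> = poly R x" by (simp add: R_def poly_fchar_poly[OF S(1)])
    \<comment> \<open>A rank one perturbation of the identity: Sylvester's identity reduces it to a
      1 by 1 determinant.\<close>
    also have "fdet S (\<lambda>a b. of_bool (a = b) - w) = fdet {()} (\<lambda>a b. (1 - s * w) * of_bool (a = b))"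
      using fdet_Sylvester[OF S(1), of "{()}" 1 "\<lambda>_ _. w" "\<lambda>_ _. 1"] by (simp add: s_def)
    also have "\<dots> = 1 - s * w" by (subst fdet_scalar) auto
    finally have "poly R x = poly P x * (1 - s * w)" by simp
    moreover have "(x - 1) * (1 - s * w) = x" using x1 s0 by (simp add: w_def field_simps)
    ultimately have "(x - 1) * poly R x = x * poly P x" by (metis mult.left_commute mult.commute)
    then show "poly ([:-1, 1:] * R) x = poly ([:-0, 1:] * P) x"
      by (simp add: algebra_simps)
  qed auto
  have "proots ([:-1, 1:] * R) = add_mset 1 (proots R)" "proots ([:-0, 1:] * P) = add_mset 0 (proots P)"
    using \<open>P \<noteq> 0\<close> \<open>R \<noteq> 0\<close> by (subst proots_mult; simp del: minus_zero)+
  with eq have pr: "add_mset 1 (proots R) = add_mset 0 (proots P)" by simp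
  \<comment> \<open>For a kernel vector \<open>v\<close> with entry sum \<open>t\<close>, adding all
    equations and using the column sums gives \<open>t = 0\<close>. Then \<open>v\<close> is
    harmonic, hence constant by \<open>harm\<close>, and a constant with sum zero vanishes. This
    yields algebraic simplicity of the eigenvalue 1 without diagonalization.\<close>
  have "poly R 1 \<noteq> 0"
  proof
    assume "poly R 1 = 0"
    then obtain v where v: "\<And>x. x \<in> S \<Longrightarrow> (\<Sum>y\<in>S. (1 * of_bool (x = y) - (f x y - 1 / s)) * v y) = 0"
      and v0: "\<exists>x\<in>S. v x \<noteq> 0"
      unfolding R_def poly_fchar_poly[OF S(1)] by (rule fdet_eq_0_imp_kernel[OF S(1)]) blast
    define t where "t = (\<Sum>y\<in>S. v y)"
    have v': "v x - (\<Sum>y\<in>S. f x y * v y) + t / s = 0" if "x \<in> S" for x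
    proof -
      have "(\<Sum>y\<in>S. (1 * of_bool (x = y) - (f x y - 1 / s)) * v y)
        = (\<Sum>y\<in>S. (if x = y then v y else 0) - f x y * v y + v y / s)"
        by (rule sum.cong) (auto simp: algebra_simps)
      also have "\<dots> = v x - (\<Sum>y\<in>S. f x y * v y) + t / s"
        using S that by (simp add: sum.distrib sum_subtractf t_def sum_divide_distrib)
      finally show ?thesis using v[OF that] by simp
    qed
    have "(\<Sum>x\<in>S. \<Sum>y\<in>S. f x y * v y) = (\<Sum>y\<in>S. (\<Sum>x\<in>S. f x y) * v y)"
      by (subst sum.swap) (simp add: sum_distrib_right)
    also have "\<dots> = t" by (simp add: col t_def)
    finally have "(\<Sum>x\<in>S. v x - (\<Sum>y\<in>S. f x y * v y) + t / s) = t - t + s * (t / s)"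
      by (simp add: sum.distrib sum_subtractf s_def flip: t_def)
    then have "t - t + s * (t / s) = 0" using v' by simp
    then have t0: "t = 0" using s0 by simp
    have const: "v x = v y" if "x \<in> S" "y \<in> S" for x y
      by (rule harm[OF _ that]) (use v' t0 in \<open>simp add: algebra_simps\<close>)
    obtain x where x: "x \<in> S" "v x \<noteq> 0" using v0 by blast
    have "t = (\<Sum>y\<in>S. v x)" unfolding t_def by (rule sum.cong) (auto intro: const x)
    then show False using x s0 t0 by (simp add: s_def)
  qed
  then have R1: "1 \<notin># proots R" using \<open>R \<noteq> 0\<close> by simp
  \<comment> \<open>As 0 and 1 differ, the extra 1 on the left of \<open>pr\<close> must occur in
    \<open>proots P\<close>. Removing it shows that \<open>M\<close> lies inside
    \<open>proots R\<close>, which does not contain 1.\<close>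
  from pr have "1 \<in># proots P" by (metis insert_noteq_member zero_neq_one union_single_eq_member)
  then obtain M where M: "proots P = add_mset 1 M" by (rule mset_add)
  with pr have "proots R = add_mset 0 M" by (simp add: add_mset_commute)
  with R1 have "1 \<notin># M" by simp
  moreover have "size M = card S - 1"
    using arg_cong[OF M, of size] by (simp add: size_proots_complex degree_monic_fchar_poly P_def)
  ultimately show thesis using that M unfolding P_def by blast
qed

section \<open>Biregular graphs and the two-step walk\<close>

locale biregular_graph =
  fixes V :: "'a set" and E :: "'a \<Rightarrow> 'a \<Rightarrow> bool" and c d :: nat and X Y :: "'a set"
  assumes simple: "simple_graph V E" and connected: "connected_graph V E"
    and parts: "biregular_parts V E c d X Y"
    and c2: "c \<ge> 2" and d2: "d \<ge> 2"
begin

lemma finite_V: "finite V" and E_V: "E u v \<Longrightarrow> u \<in> V \<and> v \<in> V" and E_sym: "E u v \<longleftrightarrow> E v u"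
  using simple by (auto simp: simple_graph_def)

lemma V_eq: "V = X \<union> Y" and disj: "X \<inter> Y = {}"
  and E_parts: "E u v \<Longrightarrow> u \<in> X \<and> v \<in> Y \<or> u \<in> Y \<and> v \<in> X"
  and deg_X: "u \<in> X \<Longrightarrow> deg V E u = c" and deg_Y: "u \<in> Y \<Longrightarrow> deg V E u = d"
  using parts by (auto simp: biregular_parts_def)

lemma finite_X: "finite X" and finite_Y: "finite Y"
  using finite_V by (auto simp: V_eq)

lemma E_X: "u \<in> X \<Longrightarrow> E u v \<Longrightarrow> v \<in> Y" and E_Y: "u \<in> Y \<Longrightarrow> E u v \<Longrightarrow> v \<in> X"
  using E_parts[of u v] disj by auto

lemma sum_adj: "(\<Sum>v\<in>V. of_bool (E u v)) = (of_nat (deg V E u) :: 'k::semiring_1)"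
  using finite_V by (simp add: of_bool_def sum.If_cases deg_def nbrs_def Int_def)

lemma sum_adj_X: "u \<in> X \<Longrightarrow> (\<Sum>v\<in>Y. of_bool (E u v)) = (of_nat c :: 'k::semiring_1)"
  unfolding deg_X[symmetric] sum_adj[symmetric]
  by (rule sum.mono_neutral_left) (use finite_V V_eq E_X in auto)

lemma sum_adj_Y: "u \<in> Y \<Longrightarrow> (\<Sum>v\<in>X. of_bool (E u v)) = (of_nat d :: 'k::semiring_1)"
  unfolding deg_Y[symmetric] sum_adj[symmetric]
  by (rule sum.mono_neutral_left) (use finite_V V_eq E_Y in auto)

lemma Y_nonempty: "Y \<noteq> {}"
proof
  assume "Y = {}"
  with connected V_eq obtain x where x: "x \<in> X" by (auto simp: connected_graph_def)
  from sum_adj_X[OF x, where 'k = nat] c2 \<open>Y = {}\<close> show False by simp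
qed

section \<open>Arcs and incidence sums\<close>

lemma arcs_eq: "arcs V E = {(u, v). E u v}"
  using E_V by (auto simp: arcs_def)

definition "arcs_from S = {(u, v). E u v \<and> u \<in> S}"

lemma arcs_split: "arcs V E = arcs_from X \<union> arcs_from Y" "arcs_from X \<inter> arcs_from Y = {}"
  using E_parts disj by (auto simp: arcs_eq arcs_from_def)

lemma finite_arcs: "finite (arcs V E)"
  by (rule finite_subset[of _ "V \<times> V"]) (auto simp: arcs_def finite_V)

lemma finite_arcs_from: "finite (arcs_from X)" "finite (arcs_from Y)"
  using finite_arcs arcs_split by auto

text \<open>Each edge has exactly one endpoint in \<open>X\<close>, hence exactly one orientation
  that starts there; reversal exchanges the two classes of arcs.\<close>

lemma card_arcs_from: "card (arcs_from X) = card (edges V E)" "card (arcs_from Y) = card (edges V E)"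
proof -
  have "bij_betw (\<lambda>(u, v). {u, v}) (arcs_from X) (edges V E)"
    unfolding bij_betw_def
  proof
    show "inj_on (\<lambda>(u, v). {u, v}) (arcs_from X)"
      using E_X disj by (auto simp: inj_on_def arcs_from_def doubleton_eq_iff)
    show "(\<lambda>(u, v). {u, v}) ` arcs_from X = edges V E"
    proof (intro equalityI subsetI)
      fix e assume "e \<in> edges V E"
      then obtain u v where e: "e = {u, v}" "E u v" by (auto simp: edges_def)
      then have "(u, v) \<in> arcs_from X \<or> (v, u) \<in> arcs_from X"
        using E_parts[OF e(2)] E_sym by (auto simp: arcs_from_def)
      then show "e \<in> (\<lambda>(u, v). {u, v}) ` arcs_from X"
        using e by (force simp: image_iff insert_commute)
    qed (use E_V in \<open>auto simp: edges_def arcs_from_def\<close>)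
  qed
  then show "card (arcs_from X) = card (edges V E)" by (rule bij_betw_same_card)
  moreover have "bij_betw prod.swap (arcs_from X) (arcs_from Y)"
    by (rule bij_betw_byWitness[where f' = prod.swap])
       (use E_X E_Y E_sym in \<open>auto simp: arcs_from_def\<close>)
  ultimately show "card (arcs_from Y) = card (edges V E)" by (metis bij_betw_same_card)
qed

lemma card_arcs: "card (arcs V E) = 2 * card (edges V E)"
  unfolding arcs_split(1) using finite_arcs_from arcs_split(2)
  by (simp add: card_Un_disjoint card_arcs_from)

lemma sum_arcs: "(\<Sum>a\<in>arcs V E. g a) = (\<Sum>u\<in>V. \<Sum>v\<in>V. of_bool (E u v) * (g (u, v) :: complex))"
proof -
  have "(\<Sum>a\<in>arcs V E. g a) = (\<Sum>a\<in>V \<times> V. of_bool (E (fst a) (snd a)) * g a)"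
    by (rule sum.mono_neutral_cong_left) (use finite_V in \<open>auto simp: arcs_def\<close>)
  then show ?thesis by (simp add: sum.cartesian_product case_prod_beta)
qed

text \<open>Start incidence times end incidence is adjacency. Together with
  \<open>sum_arcs_from\<close>, where start incidence meets itself and gives degrees, this evaluates
  the vertex matrices that Sylvester's identity produces.\<close>

lemma sum_arcs_from_to:
  "(\<Sum>a\<in>arcs V E. of_bool (u = fst a) * (of_bool (snd a = v) * z)) = of_bool (E u v) * (z :: complex)"
proof -
  have "(\<Sum>a\<in>arcs V E. of_bool (u = fst a) * (of_bool (snd a = v) * z))
    = (\<Sum>a\<in>arcs V E. if a = (u, v) then z else 0)"
    by (rule sum.cong) (auto simp: prod_eq_iff)
  then show ?thesis using finite_arcs by (auto simp: arcs_eq)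
qed

lemma sum_arcs_from:
  assumes "u \<in> V"
  shows "(\<Sum>a\<in>arcs V E. of_bool (u = fst a) * (z :: complex)) = of_nat (deg V E u) * z"
proof -
  have "(\<Sum>a\<in>arcs V E. of_bool (u = fst a) * z) = (\<Sum>u'\<in>V. if u = u' then (\<Sum>v\<in>V. of_bool (E u v) * z) else 0)"
    unfolding sum_arcs by (auto intro!: sum.cong)
  also have "\<dots> = of_nat (deg V E u) * z"
    using assms finite_V by (simp add: sum_adj flip: sum_distrib_right)
  finally show ?thesis .
qed

section \<open>The two-step walk on \<open>Y\<close>\<close>

definition two_step :: "'a \<Rightarrow> 'a \<Rightarrow> real" where
  "two_step y y' = (\<Sum>x\<in>X. of_bool (E y x) * of_bool (E x y')) / (real c * real d)"

text \<open>Degrees are constant on each side, so the divisor is the same for all pairs. The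
  symmetry turns row sums into column sums, making the walk doubly stochastic.\<close>

lemma two_step_sym: "two_step y y' = two_step y' y"
  unfolding two_step_def by (subst (1 2) E_sym) (simp add: mult.commute)

lemma two_step_nonneg: "two_step y y' \<ge> 0"
  unfolding two_step_def by (intro divide_nonneg_nonneg sum_nonneg) auto

lemma two_step_pos:
  assumes "x \<in> X" "E y x" "E x y'"
  shows "two_step y y' > 0"
  unfolding two_step_def
proof (intro divide_pos_pos sum_pos2[OF finite_X \<open>x \<in> X\<close>])
qed (use assms c2 d2 in auto)

lemma sum_two_step:
  assumes "y \<in> Y"
  shows "(\<Sum>y'\<in>Y. two_step y y') = 1"
proof -
  have "(\<Sum>y'\<in>Y. two_step y y') = (\<Sum>x\<in>X. of_bool (E y x) * (\<Sum>y'\<in>Y. of_bool (E x y'))) / (real c * real d)"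
    unfolding two_step_def sum_divide_distrib[symmetric] sum_distrib_left by (subst sum.swap) simp
  also have "\<dots> = (\<Sum>x\<in>X. of_bool (E y x) * real c) / (real c * real d)"
    by (simp add: sum_adj_X)
  also have "\<dots> = 1"
    using assms c2 d2 by (simp add: sum_adj_Y flip: sum_distrib_right)
  finally show ?thesis .
qed

text \<open>Maximum principle: where \<open>g\<close> attains its maximum, the average of the
  nonnegative gaps is zero, so \<open>g\<close> is maximal at every vertex reachable in two steps;
  connectedness carries this to all of \<open>Y\<close>.\<close>

lemma two_step_harmonic_imp_max:
  fixes g :: "'a \<Rightarrow> real"
  assumes harm: "\<And>y. y \<in> Y \<Longrightarrow> (\<Sum>y'\<in>Y. two_step y y' * g y') = g y"
    and y: "y \<in> Y"
  shows "g y = Max (g ` Y)"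
proof -
  let ?m = "Max (g ` Y)"
  have le: "g y \<le> ?m" if "y \<in> Y" for y using finite_Y that by simp
  have spread: "g y' = ?m" if "y \<in> Y" "y' \<in> Y" "g y = ?m" "x \<in> X" "E y x" "E x y'" for y y' x
  proof -
    have "(\<Sum>y'\<in>Y. two_step y y' * (?m - g y')) = 0"
      using sum_two_step[OF that(1)] harm[OF that(1)] that(3)
      by (simp add: right_diff_distrib sum_subtractf flip: sum_distrib_right)
    then have "\<forall>y'\<in>Y. two_step y y' * (?m - g y') = 0"
      using finite_Y two_step_nonneg le by (subst (asm) sum_nonneg_eq_0_iff) auto
    then show ?thesis using two_step_pos[OF that(4-6)] that(2) by auto
  qed
  obtain y0 where y0: "y0 \<in> Y" "g y0 = ?m"
    using Max_in[of "g ` Y"] finite_Y Y_nonempty by fastforce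
  \<comment> \<open>Paths in \<open>G\<close> alternate sides, but the harmonic condition concerns
    \<open>Y\<close> only. The invariant therefore records, at a vertex of \<open>X\<close>, a
    neighbour where the maximum is attained.\<close>
  define good where "good u \<longleftrightarrow> u \<in> Y \<and> g u = ?m \<or> u \<in> X \<and> (\<exists>y\<in>Y. E u y \<and> g y = ?m)" for u
  have "E\<^sup>*\<^sup>* y0 y" using connected y0 y V_eq by (auto simp: connected_graph_def)
  then have "good y"
  proof induction
    case base
    show ?case using y0 by (simp add: good_def)
  next
    case (step u v)
    show ?case
    proof (cases "u \<in> Y")
      case True
      then have "g u = ?m" using step.IH disj by (auto simp: good_def)
      then show ?thesis using True step.hyps(2) E_Y E_sym by (auto simp: good_def)
    next
      case False
      then obtain z where z: "z \<in> Y" "E u z" "g z = ?m" "u \<in> X" using step.IH by (auto simp: good_def)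
      then have "v \<in> Y" using step.hyps(2) E_X by blast
      then have "g v = ?m" using spread[of z v u] z step.hyps(2) E_sym by blast
      then show ?thesis using \<open>v \<in> Y\<close> by (simp add: good_def)
    qed
  qed
  then show ?thesis using y disj by (auto simp: good_def)
qed

lemma proots_two_step:
  obtains M where "proots (fchar_poly Y (\<lambda>y y'. complex_of_real (two_step y y'))) = add_mset 1 M"
    "1 \<notin># M" "size M = card Y - 1"
proof (rule proots_fchar_poly_doubly_stochastic)
  show "finite Y" "Y \<noteq> {}" by (fact finite_Y Y_nonempty)+
  show row: "(\<Sum>y'\<in>Y. complex_of_real (two_step y y')) = 1" if "y \<in> Y" for y
    using sum_two_step[OF that] by (metis of_real_sum of_real_1)
  show "(\<Sum>y\<in>Y. complex_of_real (two_step y y')) = 1" if "y' \<in> Y" for y'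
    using row[OF that] by (simp add: two_step_sym[of y'])
  show "v y = v y'" if harm: "\<And>y. y \<in> Y \<Longrightarrow> (\<Sum>y'\<in>Y. complex_of_real (two_step y y') * v y') = v y"
    and y: "y \<in> Y" "y' \<in> Y" for v y y'
  \<comment> \<open>The matrix is real, so real and imaginary parts of \<open>v\<close> are harmonic
    separately, and each equals its maximum everywhere.\<close>
  proof (rule complex_eqI)
    have "(\<Sum>y'\<in>Y. two_step y y' * Re (v y')) = Re (v y)" if "y \<in> Y" for y
      using arg_cong[OF harm[OF that], of Re] by simp
    from two_step_harmonic_imp_max[OF this] y show "Re (v y) = Re (v y')" by metis
    have "(\<Sum>y'\<in>Y. two_step y y' * Im (v y')) = Im (v y)" if "y \<in> Y" for y
      using arg_cong[OF harm[OF that], of Im] by simp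
    from two_step_harmonic_imp_max[OF this] y show "Im (v y) = Im (v y')" by metis
  qed
qed (use that in blast)

end

section \<open>The two arc chains\<close>

text \<open>Composes two reductions that each carry a cofactor, without dividing by it.\<close>

lemma mult_eq_chain:
  fixes p :: "'k::comm_semiring_1"
  assumes "p * a = b * f" "f * u = v * g"
  shows "p * (a * u) = b * v * g"
  using assms by (metis mult.assoc)

lemma root_sum_square_minus_1: "root_sum [:-1, 0, 1:] = 1 / 2"
proof -
  have "[:-1, 0, 1:] = [:-1, 1:] * [:-(-1), 1 :: complex:]" by simp
  also have "root_sum \<dots> = root_sum [:-1, 1:] + root_sum [:-(-1), 1:]"
    by (rule root_sum_mult) simp_all
  also have "\<dots> = 1 / 2" by (simp only: root_sum_linear) simp
  finally show ?thesis .
qed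

section \<open>The edge walk\<close>

context biregular_graph
begin

text \<open>A transition depends on the first arc only through its end and on the second only
  through its start, so the matrix factors through the vertices and Sylvester's identity
  applies.\<close>

lemma fdet_edge_walk:
  "poly (fchar_poly (arcs V E) (\<lambda>a b. complex_of_real (edge_walk V E a b))) x * x ^ card V
    = x ^ (2 * card (edges V E)) * fdet V (\<lambda>u v. x * of_bool (u = v) - of_bool (E u v) * (1 / of_nat (deg V E v)))"
proof -
  let ?u = "\<lambda>a v. of_bool (snd a = v) * (1 / complex_of_nat (deg V E v))"
  let ?v = "\<lambda>v b. of_bool (v = fst b) :: complex"
  have "(\<Sum>v\<in>V. ?u a v * ?v v b) = complex_of_real (edge_walk V E a b)"
    if "a \<in> arcs V E" for a b
  proof -
    have "(\<Sum>v\<in>V. ?u a v * ?v v b) = (\<Sum>v\<in>V. if snd a = v then complex_of_real (edge_walk V E a b) else 0)"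
      by (rule sum.cong) (auto simp: edge_walk_def)
    then show ?thesis using that finite_V by (auto simp: arcs_def)
  qed
  then have "poly (fchar_poly (arcs V E) (\<lambda>a b. complex_of_real (edge_walk V E a b))) x
    = fdet (arcs V E) (\<lambda>a b. x * of_bool (a = b) - (\<Sum>v\<in>V. ?u a v * ?v v b))"
    unfolding poly_fchar_poly[OF finite_arcs] by (intro fdet_cong finite_arcs) simp
  then show ?thesis
    using fdet_Sylvester[OF finite_arcs finite_V, of x ?u ?v]
    by (simp only: card_arcs sum_arcs_from_to)
qed

text \<open>There are no edges inside \<open>X\<close>, so its block is the scalar \<open>x\<close>
  and can be eliminated. The complement collects paths of length two between vertices of
  \<open>Y\<close>, weighted by \<open>1 / (c * d)\<close>.\<close>

lemma fchar_poly_edge_walk: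
  "poly (fchar_poly (arcs V E) (\<lambda>a b. complex_of_real (edge_walk V E a b))) x * x ^ (card V + card Y)
    = x ^ (2 * card (edges V E) + card X) *
      (\<Prod>\<mu>\<in>#proots (fchar_poly Y (\<lambda>y y'. complex_of_real (two_step y y'))). x\<^sup>2 - \<mu>)"
proof -
  let ?f = "\<lambda>u v. x * of_bool (u = v) - of_bool (E u v) * (1 / of_nat (deg V E v))"
  have "fdet V ?f * x ^ card Y = x ^ card X * fdet Y (\<lambda>y y'. x * ?f y y' - (\<Sum>t\<in>X. ?f y t * ?f t y'))"
    unfolding V_eq by (rule fdet_Schur[OF finite_X finite_Y disj]) (use E_X disj in auto)
  also have "fdet Y (\<lambda>y y'. x * ?f y y' - (\<Sum>t\<in>X. ?f y t * ?f t y'))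
    = fdet Y (\<lambda>y y'. x\<^sup>2 * of_bool (y = y') - 1 * complex_of_real (two_step y y'))"
  proof (rule fdet_cong[OF finite_Y])
    fix y y' assume y: "y \<in> Y" "y' \<in> Y"
    have "(\<Sum>t\<in>X. ?f y t * ?f t y') = (\<Sum>t\<in>X. of_bool (E y t) * of_bool (E t y') / (of_nat c * of_nat d))"
      using y disj by (intro sum.cong) (auto simp: deg_X deg_Y)
    also have "\<dots> = complex_of_real (two_step y y')"
      by (auto simp: two_step_def sum_divide_distrib of_bool_def intro!: sum.cong)
    finally show "x * ?f y y' - (\<Sum>t\<in>X. ?f y t * ?f t y')
       = x\<^sup>2 * of_bool (y = y') - 1 * complex_of_real (two_step y y')"
      using y E_Y disj by (auto simp: power2_eq_square)
  qed
  also have "\<dots> = (\<Prod>\<mu>\<in>#proots (fchar_poly Y (\<lambda>y y'. complex_of_real (two_step y y'))). x\<^sup>2 - 1 * \<mu>)"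
    by (rule fdet_scalar_minus_eq_prod_proots) (simp_all add: finite_Y)
  finally show ?thesis
    using mult_eq_chain[OF fdet_edge_walk] by (simp add: power_add)
qed

lemma kemeny_e_eq_sum_proots:
  assumes M: "proots (fchar_poly Y (\<lambda>y y'. complex_of_real (two_step y y'))) = add_mset 1 M" "1 \<notin># M"
  shows "kemeny_e V E + of_nat (card V + card Y)
    = of_nat (2 * card (edges V E) + card X) + 1 / 2 + (\<Sum>\<mu>\<in>#M. 2 / (1 - \<mu>))"
proof -
  let ?P = "fchar_poly (arcs V E) (\<lambda>a b. complex_of_real (edge_walk V E a b))"
  have P0: "?P \<noteq> 0" using degree_monic_fchar_poly(2) by (metis leading_coeff_0_iff zero_neq_one)
  have pow0: "[:-0, 1 :: complex:] ^ k \<noteq> 0" for k by simp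
  have prod0: "(\<Prod>\<mu>\<in>#N. [:-\<mu>, 0, 1 :: complex:]) \<noteq> 0" for N
    by (auto simp: prod_mset_zero_iff)
  \<comment> \<open>The monomial is written \<open>[:-0, 1:]\<close> to fit
    \<open>root_sum_linear\<close>; each root 0 contributes 1, so the exponents enter the result
    directly.\<close>
  have "?P * [:-0, 1:] ^ (card V + card Y)
    = [:-0, 1:] ^ (2 * card (edges V E) + card X) * (\<Prod>\<mu>\<in>#add_mset 1 M. [:-\<mu>, 0, 1:])"
  proof (rule poly_eqI_cofinite[of "{0}"])
    fix x :: complex assume "x \<notin> {0}"
    then show "poly (?P * [:-0, 1:] ^ (card V + card Y)) x
      = poly ([:-0, 1:] ^ (2 * card (edges V E) + card X) * (\<Prod>\<mu>\<in>#add_mset 1 M. [:-\<mu>, 0, 1:])) x"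
      using fchar_poly_edge_walk[of x] unfolding M poly_mult poly_power poly_prod_mset
      by (simp add: image_mset.compositionality o_def power2_eq_square)
  qed auto
  from arg_cong[OF this, of root_sum]
  have "root_sum ?P + of_nat (card V + card Y) * 1 = of_nat (2 * card (edges V E) + card X) * 1
     + (\<Sum>\<mu>\<in>#add_mset 1 M. root_sum [:-\<mu>, 0, 1:])"
    unfolding root_sum_mult[OF P0 pow0] root_sum_mult[OF pow0 prod0]
    by (subst (asm) root_sum_prod_mset) (simp_all add: root_sum_power root_sum_linear del: minus_zero)
  moreover note root_sum_square_minus_1
  moreover have "(\<Sum>\<mu>\<in>#M. root_sum [:-\<mu>, 0, 1:]) = (\<Sum>\<mu>\<in>#M. 2 / (1 - \<mu>))"
  proof (rule arg_cong[of _ _ sum_mset], rule image_mset_cong)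
    fix \<mu> assume "\<mu> \<in># M"
    with M have "\<mu> \<noteq> 1" by auto
    then show "root_sum [:-\<mu>, 0, 1:] = 2 / (1 - \<mu>)"
      by (subst root_sum_log_deriv) (auto simp: pderiv_pCons)
  qed
  ultimately show ?thesis by (simp add: kemeny_e_def kemeny_eq_root_sum)
qed

section \<open>The non-backtracking walk\<close>

definition nb_weight :: "'a \<Rightarrow> complex" where
  "nb_weight v = 1 / (of_nat (deg V E v) - 1)"

definition nb_prod :: complex ("\<kappa>") where
  "\<kappa> = 1 / ((of_nat c - 1) * (of_nat d - 1))"

lemma nb_weight_X: "u \<in> X \<Longrightarrow> nb_weight u = 1 / (of_nat c - 1)"
  and nb_weight_Y: "u \<in> Y \<Longrightarrow> nb_weight u = 1 / (of_nat d - 1)"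
  by (simp_all add: nb_weight_def deg_X deg_Y)

text \<open>The endpoints of an edge lie on opposite sides, so the product is the same for every
  edge. This is why weighted arc reversal squares to the scalar \<open>\<kappa>\<close>.\<close>

lemma nb_weight_mult: "E u v \<Longrightarrow> nb_weight u * nb_weight v = \<kappa>"
  by (drule E_parts) (auto simp: nb_weight_X nb_weight_Y nb_prod_def)

text \<open>Reversal exchanges arcs from \<open>X\<close> with arcs from \<open>Y\<close>, so both
  diagonal blocks are the scalar \<open>x\<close>, and going there and back contributes
  \<open>\<kappa>\<close>. The powers of \<open>x\<close> cancel since both classes have equally
  many arcs.\<close>

lemma fdet_reversal:
  assumes "x \<noteq> 0"
  shows "fdet (arcs V E) (\<lambda>a b. x * of_bool (a = b) - nb_weight (snd a) * of_bool (b = prod.swap a))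
    = (x\<^sup>2 - \<kappa>) ^ card (edges V E)"
proof -
  let ?H = "\<lambda>a b. x * of_bool (a = b) - nb_weight (snd a) * of_bool (b = prod.swap a)"
  let ?m = "card (edges V E)"
  have "fdet (arcs V E) ?H * x ^ card (arcs_from Y) = x ^ card (arcs_from X) *
      fdet (arcs_from Y) (\<lambda>a b. x * ?H a b - (\<Sum>t\<in>arcs_from X. ?H a t * ?H t b))"
    unfolding arcs_split(1)
    by (rule fdet_Schur[OF finite_arcs_from arcs_split(2)]) (use E_X disj in \<open>auto simp: arcs_from_def\<close>)
  also have "fdet (arcs_from Y) (\<lambda>a b. x * ?H a b - (\<Sum>t\<in>arcs_from X. ?H a t * ?H t b))
    = fdet (arcs_from Y) (\<lambda>a b. (x\<^sup>2 - \<kappa>) * of_bool (a = b))"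
  proof (rule fdet_cong[OF finite_arcs_from(2)])
    fix a b assume ab: "a \<in> arcs_from Y" "b \<in> arcs_from Y"
    then have a': "prod.swap a \<in> arcs_from X" using E_Y E_sym by (auto simp: arcs_from_def)
    have w: "nb_weight (snd a) * nb_weight (fst a) = \<kappa>"
      using ab E_sym by (intro nb_weight_mult) (auto simp: arcs_from_def)
    have neq: "b \<noteq> prod.swap a" using ab a' arcs_split(2) by auto
    have "(\<Sum>t\<in>arcs_from X. ?H a t * ?H t b)
      = (\<Sum>t\<in>arcs_from X. if t = prod.swap a then \<kappa> * of_bool (a = b) else 0)"
      using ab w arcs_split(2) by (intro sum.cong) auto
    also have "\<dots> = \<kappa> * of_bool (a = b)" using a' finite_arcs_from by simp
    finally show "x * ?H a b - (\<Sum>t\<in>arcs_from X. ?H a t * ?H t b) = (x\<^sup>2 - \<kappa>) * of_bool (a = b)"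
      using neq by (simp add: algebra_simps power2_eq_square)
  qed
  also have "\<dots> = (x\<^sup>2 - \<kappa>) ^ ?m"
    by (simp add: fdet_scalar finite_arcs_from card_arcs_from)
  finally show ?thesis using assms by (simp add: card_arcs_from)
qed

text \<open>Write \<open>W R\<close> for weighted arc reversal. As \<open>(W R)\<^sup>2 = \<kappa>\<close>, multiplying \<open>x - P\<close> by \<open>x - W R\<close>
  leaves a scalar minus a matrix that factors through the vertices.\<close>

lemma fdet_nb_walk:
  assumes "x \<noteq> 0" "x\<^sup>2 \<noteq> \<kappa>"
  shows "poly (fchar_poly (arcs V E) (\<lambda>a b. complex_of_real (nb_walk V E a b))) x * (x\<^sup>2 - \<kappa>) ^ card V
    = (x\<^sup>2 - \<kappa>) ^ card (edges V E) *
      fdet V (\<lambda>u v. (x\<^sup>2 - \<kappa> + \<kappa> * of_nat (deg V E u)) * of_bool (u = v) - x * nb_weight v * of_bool (E u v))"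
proof -
  let ?m = "card (edges V E)"
  let ?H = "\<lambda>a b. x * of_bool (a = b) - nb_weight (snd a) * of_bool (b = prod.swap a)"
  let ?T = "\<lambda>a b. complex_of_real (nb_walk V E a b)"
  \<comment> \<open>The two terms are what survives in the product: continuing from the end of
    \<open>a\<close>, and reversing first and then continuing from the start of \<open>a\<close>.
    Both see \<open>b\<close> only through \<open>fst b\<close>.\<close>
  let ?u = "\<lambda>a v. of_bool (snd a = v) * (x * nb_weight v) - \<kappa> * of_bool (fst a = v)"
  let ?v = "\<lambda>v b. of_bool (v = fst b) :: complex"
  let ?P = "fchar_poly (arcs V E) ?T"
  \<comment> \<open>The walk is the weighted edge step minus weighted reversal.\<close>
  have T: "?T a b = nb_weight (snd a) * (of_bool (snd a = fst b) - of_bool (b = prod.swap a))"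
    if "a \<in> arcs V E" "b \<in> arcs V E" for a b
    using that by (cases a; cases b) (auto simp: nb_walk_def nb_weight_def)
  have "(x\<^sup>2 - \<kappa>) ^ ?m * poly ?P x = fdet (arcs V E) ?H * fdet (arcs V E) (\<lambda>a b. x * of_bool (a = b) - ?T a b)"
    by (simp add: fdet_reversal assms poly_fchar_poly finite_arcs)
  also have "\<dots> = fdet (arcs V E) (\<lambda>a b. \<Sum>t\<in>arcs V E. ?H a t * (x * of_bool (t = b) - ?T t b))"
    by (rule fdet_mult[OF finite_arcs])
  also have "\<dots> = fdet (arcs V E) (\<lambda>a b. (x\<^sup>2 - \<kappa>) * of_bool (a = b) - (\<Sum>v\<in>V. ?u a v * ?v v b))"
  proof (rule fdet_cong[OF finite_arcs])
    fix a b assume ab: "a \<in> arcs V E" "b \<in> arcs V E"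
    then have a': "prod.swap a \<in> arcs V E" using E_sym by (auto simp: arcs_eq)
    have aV: "fst a \<in> V" "snd a \<in> V" using ab by (auto simp: arcs_def)
    have w: "nb_weight (snd a) * nb_weight (fst a) = \<kappa>"
      using ab E_sym by (intro nb_weight_mult) (auto simp: arcs_eq)
    let ?a' = "prod.swap a"
    let ?F = "\<lambda>t. x * of_bool (t = b) - ?T t b"
    have "(\<Sum>t\<in>arcs V E. ?H a t * ?F t)
       = (\<Sum>t\<in>arcs V E. (if a = t then x * ?F t else 0) - (if t = ?a' then nb_weight (snd a) * ?F t else 0))"
      by (rule sum.cong) (auto simp: algebra_simps)
    also have "\<dots> = x * ?F a - nb_weight (snd a) * ?F ?a'"
      using ab a' finite_arcs by (simp add: sum_subtractf)
    \<comment> \<open>After this expansion the two terms in \<open>x * of_bool (b = ?a')\<close>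
      have opposite signs and cancel, while \<open>of_bool (a = b)\<close> with coefficient
      \<open>\<kappa>\<close> joins the scalar part.\<close>
    also have "\<dots> = x * (x * of_bool (a = b)
          - nb_weight (snd a) * (of_bool (snd a = fst b) - of_bool (b = ?a')))
        - nb_weight (snd a) * x * of_bool (b = ?a')
        + (nb_weight (snd a) * nb_weight (fst a)) * (of_bool (fst a = fst b) - of_bool (a = b))"
      unfolding T[OF ab] T[OF a' ab(2)] by (auto simp: algebra_simps)
    also have "\<dots> = (x\<^sup>2 - \<kappa>) * of_bool (a = b)
        - (x * nb_weight (snd a) * of_bool (snd a = fst b) - \<kappa> * of_bool (fst a = fst b))"
      unfolding w by (simp add: algebra_simps power2_eq_square)
    also have "x * nb_weight (snd a) * of_bool (snd a = fst b) - \<kappa> * of_bool (fst a = fst b)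
        = (\<Sum>v\<in>V. (if snd a = v then x * nb_weight v * ?v v b else 0) - (if fst a = v then \<kappa> * ?v v b else 0))"
      using finite_V aV by (simp add: sum_subtractf)
    also have "\<dots> = (\<Sum>v\<in>V. ?u a v * ?v v b)"
      by (rule sum.cong) (auto simp: algebra_simps)
    finally show "(\<Sum>t\<in>arcs V E. ?H a t * ?F t) = (x\<^sup>2 - \<kappa>) * of_bool (a = b) - (\<Sum>v\<in>V. ?u a v * ?v v b)" .
  qed
  finally have "(x\<^sup>2 - \<kappa>) ^ ?m * poly ?P x * (x\<^sup>2 - \<kappa>) ^ card V
    = (x\<^sup>2 - \<kappa>) ^ card (arcs V E) *
      fdet V (\<lambda>u v. (x\<^sup>2 - \<kappa>) * of_bool (u = v) - (\<Sum>a\<in>arcs V E. ?v u a * ?u a v))"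
    using fdet_Sylvester[OF finite_arcs finite_V, of "x\<^sup>2 - \<kappa>" ?u ?v] by simp
  \<comment> \<open>The Ihara-Bass shape: the first part of \<open>?u\<close> yields weighted
    adjacency, the second the diagonal of degrees.\<close>
  also have "fdet V (\<lambda>u v. (x\<^sup>2 - \<kappa>) * of_bool (u = v) - (\<Sum>a\<in>arcs V E. ?v u a * ?u a v))
    = fdet V (\<lambda>u v. (x\<^sup>2 - \<kappa> + \<kappa> * of_nat (deg V E u)) * of_bool (u = v) - x * nb_weight v * of_bool (E u v))"
  proof (rule fdet_cong[OF finite_V])
    fix u v assume u: "u \<in> V" "v \<in> V"
    have "(\<Sum>a\<in>arcs V E. ?v u a * ?u a v) = (\<Sum>a\<in>arcs V E. ?v u a * (of_bool (snd a = v) * (x * nb_weight v)))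
       - (\<Sum>a\<in>arcs V E. ?v u a * (\<kappa> * of_bool (u = v)))"
      unfolding sum_subtractf[symmetric] by (rule sum.cong) (auto simp: algebra_simps)
    also have "\<dots> = of_bool (E u v) * (x * nb_weight v) - of_nat (deg V E u) * (\<kappa> * of_bool (u = v))"
      by (simp only: sum_arcs_from_to sum_arcs_from[OF u(1)])
    finally show "(x\<^sup>2 - \<kappa>) * of_bool (u = v) - (\<Sum>a\<in>arcs V E. ?v u a * ?u a v)
      = (x\<^sup>2 - \<kappa> + \<kappa> * of_nat (deg V E u)) * of_bool (u = v) - x * nb_weight v * of_bool (E u v)"
      by (simp add: algebra_simps)
  qed
  \<comment> \<open>Sylvester's identity gives the exponent \<open>2 * m\<close> for
    \<open>x\<^sup>2 - \<kappa>\<close>; the reversal determinant cancels \<open>m\<close> of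
    it.\<close>
  finally show ?thesis using assms by (simp add: card_arcs mult_2 power_add)
qed


lemma c_minus_1: "complex_of_nat c - 1 \<noteq> 0" and d_minus_1: "complex_of_nat d - 1 \<noteq> 0"
  using c2 d2 by simp_all

lemma kappa_nonzero: "\<kappa> \<noteq> 0"
  using c_minus_1 d_minus_1 by (simp add: nb_prod_def)

lemma fchar_poly_nb_walk:
  fixes x :: complex
  defines "A \<equiv> 1 / (of_nat d - 1)" and "B \<equiv> 1 / (of_nat c - 1)"
  assumes "x \<noteq> 0" "x\<^sup>2 \<noteq> \<kappa>"
  shows "poly (fchar_poly (arcs V E) (\<lambda>a b. complex_of_real (nb_walk V E a b))) x *
      ((x\<^sup>2 - \<kappa>) ^ card V * (x\<^sup>2 + A) ^ card Y)
    = (x\<^sup>2 - \<kappa>) ^ card (edges V E) * (x\<^sup>2 + A) ^ card X *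
      (\<Prod>\<mu>\<in>#proots (fchar_poly Y (\<lambda>y y'. complex_of_real (two_step y y'))).
         (x\<^sup>2 + A) * (x\<^sup>2 + B) - x\<^sup>2 * \<kappa> * of_nat c * of_nat d * \<mu>)"
proof -
  let ?f = "\<lambda>u v. (x\<^sup>2 - \<kappa> + \<kappa> * of_nat (deg V E u)) * of_bool (u = v) - x * nb_weight v * of_bool (E u v)"
  let ?z = "x\<^sup>2 * \<kappa> * of_nat c * of_nat d"
  \<comment> \<open>The sides cross over: \<open>\<kappa> * (c - 1)\<close> is
    \<open>1 / (d - 1)\<close>, so the diagonal on \<open>X\<close> involves \<open>d\<close> and
    the one on \<open>Y\<close> involves \<open>c\<close>.\<close>
  have diag: "x\<^sup>2 - \<kappa> + \<kappa> * of_nat c = x\<^sup>2 + A" "x\<^sup>2 - \<kappa> + \<kappa> * of_nat d = x\<^sup>2 + B"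
    using c_minus_1 d_minus_1 by (simp_all add: A_def B_def nb_prod_def divide_simps) (simp_all add: algebra_simps)
  have "fdet V ?f * (x\<^sup>2 + A) ^ card Y = (x\<^sup>2 + A) ^ card X *
      fdet Y (\<lambda>y y'. (x\<^sup>2 + A) * ?f y y' - (\<Sum>t\<in>X. ?f y t * ?f t y'))"
    unfolding V_eq by (rule fdet_Schur[OF finite_X finite_Y disj]) (use E_X disj in \<open>auto simp: deg_X diag simp flip: V_eq\<close>)
  also have "fdet Y (\<lambda>y y'. (x\<^sup>2 + A) * ?f y y' - (\<Sum>t\<in>X. ?f y t * ?f t y'))
    = fdet Y (\<lambda>y y'. ((x\<^sup>2 + A) * (x\<^sup>2 + B)) * of_bool (y = y') - ?z * complex_of_real (two_step y y'))"
  proof (rule fdet_cong[OF finite_Y])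
    fix y y' assume y: "y \<in> Y" "y' \<in> Y"
    have "(\<Sum>t\<in>X. ?f y t * ?f t y') = (\<Sum>t\<in>X. x\<^sup>2 * \<kappa> * complex_of_real (of_bool (E y t) * of_bool (E t y')))"
    proof (rule sum.cong)
      fix t assume t: "t \<in> X"
      then have "y \<noteq> t" "t \<noteq> y'" using y disj by auto
      moreover have "nb_weight t * nb_weight y' = \<kappa>" if "E t y'" using that by (rule nb_weight_mult)
      ultimately show "?f y t * ?f t y' = x\<^sup>2 * \<kappa> * complex_of_real (of_bool (E y t) * of_bool (E t y'))"
        by (auto simp: power2_eq_square)
    qed simp
    also have "\<dots> = x\<^sup>2 * \<kappa> * complex_of_real (\<Sum>t\<in>X. of_bool (E y t) * of_bool (E t y'))"
      by (simp only: sum_distrib_left of_real_sum)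
    also have "(\<Sum>t\<in>X. of_bool (E y t) * of_bool (E t y')) = real c * real d * two_step y y'"
      using c2 d2 by (simp add: two_step_def)
    finally show "(x\<^sup>2 + A) * ?f y y' - (\<Sum>t\<in>X. ?f y t * ?f t y')
       = ((x\<^sup>2 + A) * (x\<^sup>2 + B)) * of_bool (y = y') - ?z * complex_of_real (two_step y y')"
      using y E_Y disj by (auto simp: deg_Y diag)
  qed
  also have "\<dots> = (\<Prod>\<mu>\<in>#proots (fchar_poly Y (\<lambda>y y'. complex_of_real (two_step y y'))).
      (x\<^sup>2 + A) * (x\<^sup>2 + B) - ?z * \<mu>)"
    by (rule fdet_scalar_minus_eq_prod_proots) (use finite_Y assms kappa_nonzero c2 d2 in auto)
  finally show ?thesis
    by (rule mult_eq_chain[OF fdet_nb_walk[OF assms(3,4)]])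
qed

text \<open>The logarithmic derivative of each quartic factor at 1 is affine in
  \<open>1 / (1 - \<mu>)\<close>, so the sum over \<open>M\<close> is the one that also occurs for
  the edge walk.\<close>

lemma kemeny_nb_eq_sum_proots:
  assumes M: "proots (fchar_poly Y (\<lambda>y y'. complex_of_real (two_step y y'))) = add_mset 1 M" "1 \<notin># M"
    and cd: "(c, d) \<noteq> (2, 2)"
  defines "A \<equiv> 1 / (complex_of_nat d - 1)"
  shows "kemeny_nb V E + of_nat (card V) * (2 / (1 - \<kappa>)) + of_nat (card Y) * (2 / (1 + A))
    = of_nat (card (edges V E)) * (2 / (1 - \<kappa>)) + of_nat (card X) * (2 / (1 + A))
      + (1 / 2 + 2 / (1 - \<kappa>)) + 2 * of_nat (size M)
      + (1 - \<kappa>) / (\<kappa> * of_nat c * of_nat d) * (\<Sum>\<mu>\<in>#M. 2 / (1 - \<mu>))"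
proof -
  let ?P = "fchar_poly (arcs V E) (\<lambda>a b. complex_of_real (nb_walk V E a b))"
  define B where "B = 1 / (complex_of_nat c - 1)"
  define L where "L = \<kappa> * of_nat c * of_nat d"
  define q where "q \<mu> = [:\<kappa>, 0, A + B - L * \<mu>, 0, 1:]" for \<mu>
  have P0: "?P \<noteq> 0" using degree_monic_fchar_poly(2) by (metis leading_coeff_0_iff zero_neq_one)
  have pow0: "[:a, 0, 1 :: complex:] ^ k \<noteq> 0" for k a by simp
  have pp0: "[:a, 0, 1 :: complex:] ^ k * [:b, 0, 1:] ^ l \<noteq> 0" for k l a b by simp
  have prod0: "(\<Prod>\<mu>\<in>#N. q \<mu>) \<noteq> 0" for N
    by (auto simp: prod_mset_zero_iff q_def)
  have AB: "A * B = \<kappa>" by (simp add: A_def B_def nb_prod_def)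
  \<comment> \<open>That is, \<open>L = (1 + A) * (1 + B)\<close>, so \<open>q \<mu>\<close> takes
    the value \<open>L * (1 - \<mu>)\<close> at 1.\<close>
  have L: "L = A * B + A + B + 1"
    using c_minus_1 d_minus_1 by (simp add: L_def A_def B_def nb_prod_def divide_simps) (simp add: algebra_simps)
  \<comment> \<open>Next, \<open>\<kappa> = 1\<close> would force \<open>c = d = 2\<close>;
    excluding it keeps 1 from being a root of \<open>x\<^sup>2 - \<kappa>\<close>.\<close>
  have L0: "L \<noteq> 0" using kappa_nonzero c2 d2 by (simp add: L_def)
  have kappa1: "\<kappa> \<noteq> 1"
  proof
    assume "\<kappa> = 1"
    then have "(complex_of_nat c - 1) * (of_nat d - 1) = 1"
      unfolding nb_prod_def by (metis div_by_1 divide_divide_eq_right mult_1 divide_eq_1_iff)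
    then have "complex_of_nat ((c - 1) * (d - 1)) = of_nat 1" using c2 d2 by (simp add: of_nat_diff)
    then have "(c - 1) * (d - 1) = 1" by (rule of_nat_eq_iff[THEN iffD1])
    then show False using cd c2 d2 by auto
  qed
  have A1: "1 + A \<noteq> 0"
    using d_minus_1 d2 by (simp add: A_def divide_simps)
  have quad: "root_sum [:a, 0, 1:] = 2 / (1 + a)" if "1 + a \<noteq> 0" for a
    using that by (subst root_sum_log_deriv) (auto simp: pderiv_pCons add.commute)
  have "?P * ([:-\<kappa>, 0, 1:] ^ card V * [:A, 0, 1:] ^ card Y)
    = [:-\<kappa>, 0, 1:] ^ card (edges V E) * [:A, 0, 1:] ^ card X * (\<Prod>\<mu>\<in>#add_mset 1 M. q \<mu>)"
  \<comment> \<open>The exceptional points are the zeros of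
    \<open>x * (x\<^sup>2 - \<kappa>)\<close>, as required by
    \<open>fchar_poly_nb_walk\<close>.\<close>
  proof (rule poly_eqI_cofinite[of "{x. poly [:0, -\<kappa>, 0, 1:] x = 0}"])
    show "finite {x. poly [:0, -\<kappa>, 0, 1:] x = 0}" by (rule poly_roots_finite) simp
    fix x :: complex assume "x \<notin> {x. poly [:0, -\<kappa>, 0, 1:] x = 0}"
    then have x: "x \<noteq> 0" "x\<^sup>2 \<noteq> \<kappa>" by (auto simp: power2_eq_square)
    have q: "poly (q \<mu>) x = (x\<^sup>2 + A) * (x\<^sup>2 + B) - x\<^sup>2 * \<kappa> * of_nat c * of_nat d * \<mu>" for \<mu>
      unfolding q_def L_def AB[symmetric] by (simp add: algebra_simps power2_eq_square)
    show "poly (?P * ([:-\<kappa>, 0, 1:] ^ card V * [:A, 0, 1:] ^ card Y)) x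
      = poly ([:-\<kappa>, 0, 1:] ^ card (edges V E) * [:A, 0, 1:] ^ card X * (\<Prod>\<mu>\<in>#add_mset 1 M. q \<mu>)) x"
      using fchar_poly_nb_walk[OF x] unfolding M poly_mult poly_power poly_prod_mset
      by (simp add: image_mset.compositionality o_def q A_def B_def power2_eq_square add.commute[of _ "x * x"])
  qed
  from arg_cong[OF this, of root_sum]
  have "root_sum ?P + (of_nat (card V) * root_sum [:-\<kappa>, 0, 1:] + of_nat (card Y) * root_sum [:A, 0, 1:])
     = of_nat (card (edges V E)) * root_sum [:-\<kappa>, 0, 1:] + of_nat (card X) * root_sum [:A, 0, 1:]
     + (root_sum (q 1) + (\<Sum>\<mu>\<in>#M. root_sum (q \<mu>)))"
    unfolding root_sum_mult[OF P0 pp0] root_sum_mult[OF pow0 pow0] root_sum_mult[OF pp0 prod0]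
    by (subst (asm) root_sum_prod_mset) (simp_all add: root_sum_power q_def)
  moreover have "root_sum (q 1) = 1 / 2 + 2 / (1 - \<kappa>)"
  proof -
    \<comment> \<open>At \<open>\<mu> = 1\<close> the middle coefficient \<open>A + B - L\<close>
      equals \<open>- (1 + \<kappa>)\<close>, which makes the quartic split.\<close>
    have "q 1 = [:-1, 0, 1:] * [:-\<kappa>, 0, 1:]"
      using L AB by (simp add: q_def)
    then have "root_sum (q 1) = root_sum [:-1, 0, 1:] + root_sum [:-\<kappa>, 0, 1:]"
      by (simp only: root_sum_mult[of "[:-1, 0, 1:]" "[:-\<kappa>, 0, 1:]"] pCons_eq_0_iff one_neq_zero simp_thms)
    then show ?thesis
      using kappa1 by (simp add: quad root_sum_square_minus_1)
  qed
  moreover have "(\<Sum>\<mu>\<in>#M. root_sum (q \<mu>)) = (\<Sum>\<mu>\<in>#M. 2 + (1 - \<kappa>) / L * (2 / (1 - \<mu>)))"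
  proof (rule arg_cong[of _ _ sum_mset], rule image_mset_cong)
    fix \<mu> assume "\<mu> \<in># M"
    with M have \<mu>: "1 - \<mu> \<noteq> 0" by auto
    have q1: "poly (q \<mu>) 1 = L * (1 - \<mu>)"
      using L AB by (simp add: q_def algebra_simps)
    moreover have "poly (pderiv (q \<mu>)) 1 = 2 * (L * (1 - \<mu>)) + 2 * (1 - \<kappa>)"
      using L AB by (simp add: q_def pderiv_pCons algebra_simps)
    ultimately show "root_sum (q \<mu>) = 2 + (1 - \<kappa>) / L * (2 / (1 - \<mu>))"
      using \<mu> L0 by (subst root_sum_log_deriv) (auto simp: add_divide_distrib)
  qed
  moreover have "\<dots> = 2 * of_nat (size M) + (1 - \<kappa>) / L * (\<Sum>\<mu>\<in>#M. 2 / (1 - \<mu>))"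
    by (induction M) (simp_all add: algebra_simps)
  ultimately show ?thesis
    using quad[of "-\<kappa>"] quad[of A] kappa1 A1 by (simp add: kemeny_nb_def kemeny_eq_root_sum L_def algebra_simps)
qed

end


section \<open>Elimination of the two-step spectrum\<close>

theorem theorem4p2:
  fixes V :: "'a set" and E :: "'a \<Rightarrow> 'a \<Rightarrow> bool" and c d :: nat and X Y :: "'a set"
  assumes "simple_graph V E" and "connected_graph V E"
    and "biregular_parts V E c d X Y"
    and "c \<ge> 2" and "d \<ge> 2" and "(c, d) \<noteq> (2, 2)"
    and "card X \<ge> card Y"
  shows "kemeny_nb V E =
    (let n = real (card V); m = real (card (edges V E));
         r = real (card X); s = real (card Y); c' = real c; d' = real d in
     complex_of_real
      (2 * (m - n + 1) * (c' - 1) * (d' - 1) / ((c' - 1) * (d' - 1) - 1)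
       + 2 * (r - s) * (d' - 1) / d' + 1 / 2 + 2 * (s - 1))
     + complex_of_real ((c' * d' - c' - d') / (c' * d'))
       * (kemeny_e V E - complex_of_real (2 * m - n + 1 / 2 + (r - s))))"
proof -
  interpret biregular_graph V E c d X Y using assms by unfold_locales
  obtain M where M: "proots (fchar_poly Y (\<lambda>y y'. complex_of_real (two_step y y'))) = add_mset 1 M"
    "1 \<notin># M" "size M = card Y - 1"
    by (rule proots_two_step)
  \<comment> \<open>Both Kemeny constants are affine in \<open>S\<close>; solving the edge walk
    formula for \<open>S\<close> and substituting relates them directly.\<close>
  define S where "S = (\<Sum>\<mu>\<in>#M. 2 / (1 - \<mu>))"
  define n m r s C D :: complex where "n = of_nat (card V)" and "m = of_nat (card (edges V E))"
    and "r = of_nat (card X)" and "s = of_nat (card Y)" and "C = of_nat c" and "D = of_nat d"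
  have size: "complex_of_nat (size M) = s - 1"
    using Y_nonempty finite_Y by (simp add: M s_def of_nat_diff Suc_leI card_gt_0_iff)
  have "C - 1 \<noteq> 0" "D - 1 \<noteq> 0" "C \<noteq> 0" "D \<noteq> 0"
    using c_minus_1 d_minus_1 c2 d2 by (simp_all add: C_def D_def)
  have kap: "\<kappa> = 1 / ((C - 1) * (D - 1))" by (simp add: nb_prod_def C_def D_def)
  have "2 / (1 - \<kappa>) = 2 * (C - 1) * (D - 1) / ((C - 1) * (D - 1) - 1)"
    using \<open>C - 1 \<noteq> 0\<close> \<open>D - 1 \<noteq> 0\<close> unfolding kap by (simp add: divide_simps)
  moreover have "2 / (1 + 1 / (D - 1)) = 2 * (D - 1) / D"
    using \<open>D - 1 \<noteq> 0\<close> \<open>D \<noteq> 0\<close> by (simp add: divide_simps)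
  \<comment> \<open>Since
    \<open>1 / \<kappa> - 1 = (C - 1) * (D - 1) - 1 = C * D - C - D\<close>.\<close>
  moreover have "(1 - \<kappa>) / (\<kappa> * C * D) = (C * D - C - D) / (C * D)"
    using \<open>C - 1 \<noteq> 0\<close> \<open>D - 1 \<noteq> 0\<close> \<open>C \<noteq> 0\<close> \<open>D \<noteq> 0\<close> unfolding kap
    by (simp add: divide_simps) (simp add: algebra_simps)
  moreover have "S = kemeny_e V E - (2 * m - n + 1 / 2 + (r - s))"
    using kemeny_e_eq_sum_proots[OF M(1,2)] unfolding S_def n_def m_def r_def s_def by (simp add: algebra_simps)
  \<comment> \<open>The \<open>+ 1\<close> beside \<open>m - n\<close> and the \<open>1 / 2\<close>
    both come from the split quartic at \<open>\<mu> = 1\<close>; \<open>s - 1\<close> counts the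
    other eigenvalues.\<close>
  moreover have "kemeny_nb V E = (m - n + 1) * (2 / (1 - \<kappa>)) + (r - s) * (2 / (1 + 1 / (D - 1)))
      + 1 / 2 + 2 * (s - 1) + (1 - \<kappa>) / (\<kappa> * C * D) * S"
    using kemeny_nb_eq_sum_proots[OF M(1,2) assms(6)] unfolding size S_def[symmetric]
    unfolding n_def[symmetric] m_def[symmetric] r_def[symmetric] s_def[symmetric] C_def[symmetric] D_def[symmetric]
    by (simp add: algebra_simps add_divide_distrib diff_divide_distrib)
  moreover have "(m - n + 1) * (2 * (C - 1) * (D - 1) / ((C - 1) * (D - 1) - 1))
      = 2 * (m - n + 1) * (C - 1) * (D - 1) / ((C - 1) * (D - 1) - 1)"
    "(r - s) * (2 * (D - 1) / D) = 2 * (r - s) * (D - 1) / D"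
    by (simp_all only: times_divide_eq_right mult_ac)
  ultimately have "kemeny_nb V E = 2 * (m - n + 1) * (C - 1) * (D - 1) / ((C - 1) * (D - 1) - 1)
      + 2 * (r - s) * (D - 1) / D + 1 / 2 + 2 * (s - 1)
      + (C * D - C - D) / (C * D) * (kemeny_e V E - (2 * m - n + 1 / 2 + (r - s)))"
    by (simp only:)
  then show ?thesis
    by (simp add: Let_def n_def m_def r_def s_def C_def D_def)
qed

end
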